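(* Let $n \geq 3$ and let $e_1,\dots,e_n$ be the standard basis of $\mathbb{C}^n$. The tensor $T \in \mathbb{C}^n \otimes \mathbb{C}^n \otimes \mathbb{C}^n$ given by \[ T = \sum_{k=1}^{n-1} e_1 \otimes e_n \otimes e_k + \sum_{i=2}^n e_i \otimes e_{n+1-i}\otimes e_{n+1-i}+\sum_{i=1}^{n-1}e_i \otimes e_{n-i}\otimes e_n \] is non-free. In fact, a generic tensor with support contained in \[ \{(i,j,k) \in [n]^3 \mid (k < n \text{ and } i+j=n+1) \text{ or } (k = n \text{ and } i+j = n)\} \] is equivalent to the tensor $T$, and hence non-free.
   Context: Notation: $[n]=\{1,\dots,n\}$. For $T \in \mathbb{C}^n\otimes\mathbb{C}^n\otimes\mathbb{C}^n$, written $T=\sum T_{i,j,k}\, e_i\otimes e_j\otimes e_k$, its support is $\operatorname{supp}(T)=\{(i,j,k)\in[n]^3 \mid T_{i,j,k}\neq 0\}$. A subset of $[n]^3$ is called free if any two distinct elements of it differ in at least two coordinates. A tensor $T$ is called free if there exist $g_1,g_2,g_3\in \mathrm{GL}_n(\mathbb{C})$ such that $\operatorname{supp}((g_1\otimes g_2\otimes g_3)T)$ is free; otherwise it is non-free. Two tensors are equivalent if they lie in the same orbit under the action $(g_1,g_2,g_3)\cdot T=(g_1\otimes g_2\otimes g_3)T$ of $\mathrm{GL}_n(\mathbb{C})^3$. "A generic tensor with support contained in $\Gamma$" means: all tensors in some non-empty Zariski-open (hence dense) subset of the linear subspace $\{S \mid \operatorname{supp}(S)\subseteq \Gamma\}$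 of $\mathbb{C}^n\otimes\mathbb{C}^n\otimes\mathbb{C}^n$. *)

theory Defs
  imports Complex_Main "Jordan_Normal_Form.Matrix"
begin

text \<open>
  A tensor in \<open>\<complex>\<^sup>n \<otimes> \<complex>\<^sup>n \<otimes> \<complex>\<^sup>n\<close> is given by its coefficients \<open>T (i, j, k)\<close> with respect to the
  standard basis, with \<open>i, j, k\<close> ranging over \<open>{1..n}\<close>; coefficients at all other indices are \<open>0\<close>.
\<close>

type_synonym tensor = "nat \<times> nat \<times> nat \<Rightarrow> complex"

definition cube :: "nat \<Rightarrow> (nat \<times> nat \<times> nat) set" where
  "cube n = {1..n} \<times> {1..n} \<times> {1..n}"

definition tensor_space :: "nat \<Rightarrow> tensor set" where
  "tensor_space n = {T. \<forall>p. p \<notin> cube n \<longrightarrow> T p = 0}"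

definition supp :: "nat \<Rightarrow> tensor \<Rightarrow> (nat \<times> nat \<times> nat) set" where
  "supp n T = {p \<in> cube n. T p \<noteq> 0}"

definition std_basis :: "nat \<Rightarrow> nat \<Rightarrow> complex" where
  "std_basis i = (\<lambda>m. if m = i then 1 else 0)"

definition pure_tensor ::
  "(nat \<Rightarrow> complex) \<Rightarrow> (nat \<Rightarrow> complex) \<Rightarrow> (nat \<Rightarrow> complex) \<Rightarrow> tensor" where
  "pure_tensor u v w = (\<lambda>(i, j, k). u i * v j * w k)"

abbreviation basis_tensor :: "nat \<Rightarrow> nat \<Rightarrow> nat \<Rightarrow> tensor" where
  "basis_tensor i j k \<equiv> pure_tensor (std_basis i) (std_basis j) (std_basis k)"

definition GL :: "nat \<Rightarrow> complex mat set" where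
  "GL n = {A \<in> carrier_mat n n. invertible_mat A}"

text \<open>
  The tensor \<open>(A \<otimes> B \<otimes> C) T\<close> in coordinates. Matrix entries are indexed from \<open>0\<close>, tensor coefficients
  from \<open>1\<close>, whence the shifts.
\<close>

definition act :: "nat \<Rightarrow> complex mat \<Rightarrow> complex mat \<Rightarrow> complex mat \<Rightarrow> tensor \<Rightarrow> tensor" where
  "act n A B C T = (\<lambda>(a, b, c).
     if (a, b, c) \<in> cube n then
       (\<Sum>i = 1..n. \<Sum>j = 1..n. \<Sum>k = 1..n.
          A $$ (a - 1, i - 1) * B $$ (b - 1, j - 1) * C $$ (c - 1, k - 1) * T (i, j, k))
     else 0)"

definition equivalent_tensors :: "nat \<Rightarrow> tensor \<Rightarrow> tensor \<Rightarrow> bool" where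
  "equivalent_tensors n S T \<longleftrightarrow> (\<exists>A \<in> GL n. \<exists>B \<in> GL n. \<exists>C \<in> GL n. S = act n A B C T)"

definition free_set :: "(nat \<times> nat \<times> nat) set \<Rightarrow> bool" where
  "free_set X \<longleftrightarrow>
     (\<forall>(i, j, k) \<in> X. \<forall>(i', j', k') \<in> X. (i, j, k) \<noteq> (i', j', k') \<longrightarrow>
        (i \<noteq> i' \<and> j \<noteq> j') \<or> (i \<noteq> i' \<and> k \<noteq> k') \<or> (j \<noteq> j' \<and> k \<noteq> k'))"

definition free_tensor :: "nat \<Rightarrow> tensor \<Rightarrow> bool" where
  "free_tensor n T \<longleftrightarrow>
     (\<exists>A \<in> GL n. \<exists>B \<in> GL n. \<exists>C \<in> GL n. free_set (supp n (act n A B C T)))"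

text \<open>
  Polynomial functions on the tensor space, in the \<open>n\<^sup>3\<close> coefficients of the tensor.
\<close>

inductive_set polynomial_functions :: "nat \<Rightarrow> (tensor \<Rightarrow> complex) set" for n :: nat where
  const: "(\<lambda>T. c) \<in> polynomial_functions n"
| coord: "p \<in> cube n \<Longrightarrow> (\<lambda>T. T p) \<in> polynomial_functions n"
| add: "f \<in> polynomial_functions n \<Longrightarrow> g \<in> polynomial_functions n \<Longrightarrow>
          (\<lambda>T. f T + g T) \<in> polynomial_functions n"
| mult: "f \<in> polynomial_functions n \<Longrightarrow> g \<in> polynomial_functions n \<Longrightarrow>
          (\<lambda>T. f T * g T) \<in> polynomial_functions n"

definition zariski_closed :: "nat \<Rightarrow> tensor set \<Rightarrow> bool" where
  "zariski_closed n Z \<longleftrightarrow>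
     (\<exists>F \<subseteq> polynomial_functions n. Z = {T \<in> tensor_space n. \<forall>f \<in> F. f T = 0})"

definition zariski_open_in :: "nat \<Rightarrow> tensor set \<Rightarrow> tensor set \<Rightarrow> bool" where
  "zariski_open_in n L U \<longleftrightarrow> (\<exists>Z. zariski_closed n Z \<and> U = L - Z)"

definition supported_in :: "nat \<Rightarrow> (nat \<times> nat \<times> nat) set \<Rightarrow> tensor set" where
  "supported_in n \<Gamma> = {S \<in> tensor_space n. supp n S \<subseteq> \<Gamma>}"

definition generic_supported_in ::
  "nat \<Rightarrow> (nat \<times> nat \<times> nat) set \<Rightarrow> (tensor \<Rightarrow> bool) \<Rightarrow> bool" where
  "generic_supported_in n \<Gamma> P \<longleftrightarrow>
     (\<exists>U. U \<noteq> {} \<and> zariski_open_in n (supported_in n \<Gamma>) U \<and> (\<forall>S \<in> U. P S))"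

definition special_tensor :: "nat \<Rightarrow> tensor" where
  "special_tensor n = (\<lambda>p.
     (\<Sum>k = 1..n - 1. basis_tensor 1 n k p)
     + (\<Sum>i = 2..n. basis_tensor i (n + 1 - i) (n + 1 - i) p)
     + (\<Sum>i = 1..n - 1. basis_tensor i (n - i) n p))"

definition special_support :: "nat \<Rightarrow> (nat \<times> nat \<times> nat) set" where
  "special_support n =
     {(i, j, k). (i, j, k) \<in> cube n \<and> ((k < n \<and> i + j = n + 1) \<or> (k = n \<and> i + j = n))}"

lemma special_tensor_in_supported_in:
  assumes "n \<ge> 1"
  shows "special_tensor n \<in> supported_in n (special_support n)"
proof -
  have "p \<in> special_support n" if "special_tensor n p \<noteq> 0" for p
  proof (rule ccontr)
    assume np: "p \<notin> special_support n"
    obtain a b c where p: "p = (a, b, c)" by (cases p)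
    have 1: "basis_tensor 1 n k p = 0" if "k \<in> {1..n - 1}" for k
      using np that assms unfolding p
      by (auto simp: pure_tensor_def std_basis_def special_support_def cube_def)
    have 2: "basis_tensor i (n + 1 - i) (n + 1 - i) p = 0" if "i \<in> {2..n}" for i
      using np that assms unfolding p
      by (auto simp: pure_tensor_def std_basis_def special_support_def cube_def)
    have 3: "basis_tensor i (n - i) n p = 0" if "i \<in> {1..n - 1}" for i
      using np that assms unfolding p
      by (auto simp: pure_tensor_def std_basis_def special_support_def cube_def)
    have "special_tensor n p = 0"
      unfolding special_tensor_def using 1 2 3 by (simp add: sum.neutral)
    with that show False by simp
  qed
  then show ?thesis
    by (force simp: supported_in_def tensor_space_def supp_def special_support_def)
qed

end

theory Submission
  imports Defs "Jordan_Normal_Form.Determinant"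
begin

text \<open>
  Reverse the order of the second basis. The slices of the tensor in the third direction then
  span the pencil of all \<open>diag(d) + t N\<close>, where \<open>N\<close> is the nilpotent shift and
  \<open>d\<^sub>1 = d\<^sub>2 + \<dots> + d\<^sub>n\<close>. Suppose that the support is free in other bases. Let \<open>u\<close> and \<open>v\<close>
  be the new coordinate vectors of \<open>e\<^sub>1\<close> in the column and in the row space, so that every slice
  maps \<open>u\<close> to a multiple of \<open>v\<close>, and let \<open>J\<close> and \<open>I\<close> be their supports. By freeness, slices with
  a nonzero multiple restrict on \<open>J\<close> and \<open>I\<close> to permutation matrices with rows scaled by \<open>v\<close> and
  columns scaled by \<open>1 / u\<close>, and the other slices vanish there. Hence, for invertible
  \<open>D = diag(d)\<close>, the map \<open>D\<inverse> N\<close> sends the vectors supported on \<open>J\<close> into the hyperplane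
  \<open>(\<Sum>j\<in>J. x\<^sub>j / u\<^sub>j) = 0\<close>. If \<open>card J > 1\<close>, then some iterate of it reaches a nonzero multiple
  of \<open>u\<close>, which does not lie in this hyperplane. So \<open>e\<^sub>1\<close> is a new basis vector up to a scalar,
  and by induction \<open>e\<^sub>s\<close> is one modulo the earlier ones. Each \<open>d\<^sub>s\<close> is then an entry of the free
  pencil up to a scalar, so as a linear form it is a multiple of a single coordinate. This
  contradicts \<open>d\<^sub>1 = d\<^sub>2 + \<dots> + d\<^sub>n\<close>, where \<open>d\<^sub>2, \<dots>, d\<^sub>n\<close> are independent and \<open>n \<ge> 3\<close>.

  For a generic tensor with the given support, the first antidiagonal is a linear combination of
  the others with nonzero coefficients (by Cramer's rule), and a diagonal change of the first two
  bases normalises these coefficients and the second family of entries simultaneously.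
\<close>

section \<open>Linear algebra over finite index sets\<close>

text \<open>Gaussian elimination: an equation with a nonzero coefficient at some \<open>j0\<close>
  is solved for \<open>x j0\<close> and substituted into the others.\<close>

lemma homogeneous_system_nontrivial:
  fixes a :: "'i \<Rightarrow> 'j \<Rightarrow> 'f::field"
  assumes "finite I" "finite J" "card I < card J"
  shows "\<exists>x. (\<exists>j\<in>J. x j \<noteq> 0) \<and> (\<forall>i\<in>I. (\<Sum>j\<in>J. a i j * x j) = 0)"
  using assms
proof (induction I arbitrary: J a rule: finite_induct)
  case empty
  then have "J \<noteq> {}" by auto
  then show ?case by (intro exI[of _ "\<lambda>_. 1"]) auto
next
  case (insert i I)
  show ?case
  proof (cases "\<forall>j\<in>J. a i j = 0")
    case True
    have "card I < card J" using insert.prems insert.hyps by simp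
    with insert.IH[of J a] insert.prems(1) obtain x
      where "\<exists>j\<in>J. x j \<noteq> 0" "\<forall>i\<in>I. (\<Sum>j\<in>J. a i j * x j) = 0" by blast
    with True show ?thesis by (intro exI[of _ x]) auto
  next
    case False
    then obtain j0 where j0: "j0 \<in> J" "a i j0 \<noteq> 0" by blast
    define J' where "J' = J - {j0}"
    have J': "finite J'" "card I < card J'"
      using insert.prems insert.hyps j0 by (auto simp: J'_def)
    obtain x where x: "\<exists>j\<in>J'. x j \<noteq> 0"
      and x0: "\<And>i'. i' \<in> I \<Longrightarrow> (\<Sum>j\<in>J'. (a i' j - a i' j0 * a i j / a i j0) * x j) = 0"
      using insert.IH[OF J', of "\<lambda>i' j. a i' j - a i' j0 * a i j / a i j0"] by blast
    define y where "y = x(j0 := - (\<Sum>j\<in>J'. a i j * x j) / a i j0)"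
    have split: "(\<Sum>j\<in>J. a i' j * y j) = a i' j0 * y j0 + (\<Sum>j\<in>J'. a i' j * x j)" for i'
    proof -
      have "(\<Sum>j\<in>J'. a i' j * y j) = (\<Sum>j\<in>J'. a i' j * x j)"
        by (rule sum.cong) (auto simp: J'_def y_def)
      then show ?thesis
        using sum.remove[OF \<open>finite J\<close> j0(1), of "\<lambda>j. a i' j * y j"] by (simp add: J'_def)
    qed
    have "(\<Sum>j\<in>J. a i' j * y j) = 0" if "i' \<in> I" for i'
    proof -
      have "(\<Sum>j\<in>J'. a i' j * x j) = a i' j0 / a i j0 * (\<Sum>j\<in>J'. a i j * x j)"
        using x0[OF that] by (simp add: left_diff_distrib sum_subtractf sum_distrib_left mult.assoc)
      then show ?thesis unfolding split by (simp add: y_def)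
    qed
    moreover have "(\<Sum>j\<in>J. a i j * y j) = 0"
      unfolding split using j0 by (simp add: y_def)
    moreover have "\<exists>j\<in>J. y j \<noteq> 0"
      using x by (auto simp: J'_def y_def)
    ultimately show ?thesis by blast
  qed
qed

text \<open>Only coordinates in \<open>J\<close> are tested, so the same vectors can be restricted
  to ever smaller coordinate sets.\<close>

definition indep_family :: "'s set \<Rightarrow> ('s \<Rightarrow> 'j \<Rightarrow> 'f::field) \<Rightarrow> 'j set \<Rightarrow> bool" where
  "indep_family S u J \<longleftrightarrow>
     (\<forall>c. (\<forall>j\<in>J. (\<Sum>s\<in>S. c s * u s j) = 0) \<longrightarrow> (\<forall>s\<in>S. c s = 0))"

lemma indep_familyD:
  assumes "indep_family S u J" "\<And>j. j \<in> J \<Longrightarrow> (\<Sum>s\<in>S. c s * u s j) = 0" "s \<in> S"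
  shows "c s = 0"
  using assms unfolding indep_family_def by blast

lemma indep_family_eqD:
  assumes "indep_family S u J"
    and "\<And>j. j \<in> J \<Longrightarrow> (\<Sum>s\<in>S. c s * u s j) = (\<Sum>s\<in>S. d s * u s j)" and "s \<in> S"
  shows "c s = d s"
  using indep_familyD[OF assms(1), of "\<lambda>s. c s - d s"] assms(2,3)
  by (simp add: left_diff_distrib sum_subtractf)

lemma indep_family_card_le:
  assumes "indep_family S u J" "finite S" "finite J"
  shows "card S \<le> card J"
proof (rule ccontr)
  assume "\<not> card S \<le> card J"
  then obtain x where "\<exists>s\<in>S. x s \<noteq> 0" "\<forall>j\<in>J. (\<Sum>s\<in>S. u s j * x s) = 0"
    using homogeneous_system_nontrivial[of J S "\<lambda>j s. u s j"] assms by auto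
  then show False
    using indep_familyD[OF assms(1), of x] by (auto simp: mult.commute)
qed

text \<open>Adjoining \<open>x\<close> (as \<open>None\<close>) gives more vectors than coordinates,
  hence a linear relation, in which independence makes the coefficient of \<open>x\<close>
  nonzero.\<close>

lemma indep_family_spans:
  assumes u: "indep_family S u J" and fin: "finite S" "finite J" and card: "card S = card J"
  shows "\<exists>c. \<forall>j\<in>J. x j = (\<Sum>s\<in>S. c s * u s j)"
proof -
  define S' where "S' = insert None (Some ` S)"
  define w where "w j t = (case t of None \<Rightarrow> - x j | Some s \<Rightarrow> u s j)" for j t
  have "finite S'" "card J < card S'"
    using fin card by (auto simp: S'_def card_image)
  then obtain y where y: "\<exists>t\<in>S'. y t \<noteq> 0" and y0: "\<forall>j\<in>J. (\<Sum>t\<in>S'. w j t * y t) = 0"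
    using homogeneous_system_nontrivial[of J S' w] fin by blast
  have sum_w: "(\<Sum>t\<in>S'. w j t * y t) = - x j * y None + (\<Sum>s\<in>S. y (Some s) * u s j)" for j
    using fin by (simp add: S'_def w_def sum.reindex mult.commute)
  have "y None \<noteq> 0"
  proof
    assume "y None = 0"
    then have "\<forall>s\<in>S. y (Some s) = 0"
      using indep_familyD[OF u, of "\<lambda>s. y (Some s)"] y0 by (simp add: sum_w)
    with \<open>y None = 0\<close> y show False by (auto simp: S'_def)
  qed
  moreover have "x j * y None = (\<Sum>s\<in>S. y (Some s) * u s j)" if "j \<in> J" for j
    using y0 that by (simp add: sum_w)
  ultimately have "x j = (\<Sum>s\<in>S. y (Some s) * u s j) / y None" if "j \<in> J" for j
    using that by (simp add: eq_divide_eq)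
  then show ?thesis
    by (intro exI[of _ "\<lambda>s. y (Some s) / y None"]) (simp add: sum_divide_distrib)
qed

section \<open>Bidiagonal pencils with free support\<close>

text \<open>
  The numbers \<open>a i j k\<close> are the entries of slice \<open>k\<close> of a tensor with free support. With respect to
  the bases \<open>u\<close> and \<open>v\<close> the slices are upper bidiagonal, with diagonal entries \<open>\<alpha> s k\<close> and constant
  superdiagonal entry \<open>\<tau> k\<close>; this is part of the predicate \<open>adapted\<close> below, with a convention that
  makes the superdiagonal term vanish in the first column. The coefficients \<open>\<delta>\<close> and \<open>\<nu>\<close> combine the
  slices to an invertible diagonal and to the nilpotent shift matrix.
\<close>

locale free_bidiagonal_pencil =
  fixes n :: nat and K :: "'k set" and a :: "'i \<Rightarrow> 'j \<Rightarrow> 'k \<Rightarrow> 'f::field_char_0"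
    and u :: "nat \<Rightarrow> 'j \<Rightarrow> 'f" and v :: "nat \<Rightarrow> 'i \<Rightarrow> 'f"
    and \<alpha> :: "nat \<Rightarrow> 'k \<Rightarrow> 'f" and \<tau> \<delta> \<nu> :: "'k \<Rightarrow> 'f"
  assumes finite_K: "finite K"
    and free_k: "a i j k \<noteq> 0 \<Longrightarrow> a i j k' \<noteq> 0 \<Longrightarrow> k = k'"
    and free_j: "a i j k \<noteq> 0 \<Longrightarrow> a i j' k \<noteq> 0 \<Longrightarrow> j = j'"
    and free_i: "a i j k \<noteq> 0 \<Longrightarrow> a i' j k \<noteq> 0 \<Longrightarrow> i = i'"
    and delta_alpha: "s \<in> {1..n} \<Longrightarrow> (\<Sum>k\<in>K. \<delta> k * \<alpha> s k) \<noteq> 0"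
    and delta_tau: "(\<Sum>k\<in>K. \<delta> k * \<tau> k) = 0"
    and nu_alpha: "s \<in> {1..n} \<Longrightarrow> (\<Sum>k\<in>K. \<nu> k * \<alpha> s k) = 0"
    and nu_tau: "(\<Sum>k\<in>K. \<nu> k * \<tau> k) = 1"
begin

text \<open>Stage \<open>p\<close> of a descent: \<open>I\<close> and \<open>J\<close> are the rows
  and columns left after splitting off the basis vectors before \<open>p\<close>. Vanishing of
  \<open>v (p - 1)\<close> on \<open>I\<close> makes every slice map \<open>u p\<close> to a
  multiple of \<open>v p\<close>.\<close>

definition adapted :: "nat \<Rightarrow> 'i set \<Rightarrow> 'j set \<Rightarrow> bool" where
  "adapted p I J \<longleftrightarrow>
     finite I \<and> finite J \<and> card I = Suc n - p \<and> card J = Suc n - p \<and>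
     (\<forall>i\<in>I. v (p - 1) i = 0) \<and> indep_family {p..n} u J \<and> indep_family {p..n} v I \<and>
     (\<forall>i\<in>I. \<forall>s\<in>{p..n}. \<forall>k\<in>K.
        (\<Sum>j\<in>J. a i j k * u s j) = \<alpha> s k * v s i + \<tau> k * v (s - 1) i)"

section \<open>Combinations of slices in the adapted bases\<close>

lemma row_sum:
  assumes "finite J" "j \<in> J" "a i j k \<noteq> 0"
  shows "(\<Sum>j\<in>J. a i j k * f j) = a i j k * f j"
proof -
  have "(\<Sum>j\<in>J - {j}. a i j k * f j) = 0"
    using free_j[OF assms(3)] by (intro sum.neutral) auto
  then show ?thesis
    using sum.remove[OF assms(1,2), of "\<lambda>j. a i j k * f j"] by simp
qed

definition slice :: "('k \<Rightarrow> 'f) \<Rightarrow> 'i \<Rightarrow> 'j \<Rightarrow> 'f" where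
  "slice w i j = (\<Sum>k\<in>K. w k * a i j k)"

lemma slice_sum: "(\<Sum>j\<in>J. slice w i j * x j) = (\<Sum>k\<in>K. w k * (\<Sum>j\<in>J. a i j k * x j))"
  unfolding slice_def sum_distrib_left sum_distrib_right
  by (subst sum.swap) (simp add: mult.assoc)

lemma slice_apply:
  assumes "adapted p I J" "i \<in> I" "\<And>j. j \<in> J \<Longrightarrow> x j = (\<Sum>s\<in>{p..n}. c s * u s j)"
  shows "(\<Sum>j\<in>J. slice w i j * x j) =
    (\<Sum>s\<in>{p..n}. c s * ((\<Sum>k\<in>K. w k * \<alpha> s k) * v s i + (\<Sum>k\<in>K. w k * \<tau> k) * v (s - 1) i))"
proof -
  have "(\<Sum>j\<in>J. a i j k * x j) = (\<Sum>s\<in>{p..n}. c s * (\<alpha> s k * v s i + \<tau> k * v (s - 1) i))"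
    if "k \<in> K" for k
  proof -
    have "(\<Sum>j\<in>J. a i j k * x j) = (\<Sum>j\<in>J. \<Sum>s\<in>{p..n}. c s * (a i j k * u s j))"
      using assms(3) by (intro sum.cong) (simp_all add: sum_distrib_left algebra_simps)
    also have "\<dots> = (\<Sum>s\<in>{p..n}. c s * (\<Sum>j\<in>J. a i j k * u s j))"
      by (subst sum.swap) (simp add: sum_distrib_left)
    also have "\<dots> = (\<Sum>s\<in>{p..n}. c s * (\<alpha> s k * v s i + \<tau> k * v (s - 1) i))"
      using assms(1,2) that by (intro sum.cong) (auto simp: adapted_def)
    finally show ?thesis .
  qed
  then have "(\<Sum>j\<in>J. slice w i j * x j) =
      (\<Sum>k\<in>K. \<Sum>s\<in>{p..n}. w k * (c s * (\<alpha> s k * v s i + \<tau> k * v (s - 1) i)))"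
    unfolding slice_sum sum_distrib_left[symmetric] by (intro sum.cong) auto
  also have "\<dots> = (\<Sum>s\<in>{p..n}. \<Sum>k\<in>K. w k * (c s * (\<alpha> s k * v s i + \<tau> k * v (s - 1) i)))"
    by (rule sum.swap)
  also have "\<dots> = (\<Sum>s\<in>{p..n}. c s *
      ((\<Sum>k\<in>K. w k * \<alpha> s k) * v s i + (\<Sum>k\<in>K. w k * \<tau> k) * v (s - 1) i))"
  proof (rule sum.cong[OF refl])
    fix s
    show "(\<Sum>k\<in>K. w k * (c s * (\<alpha> s k * v s i + \<tau> k * v (s - 1) i))) = c s *
      ((\<Sum>k\<in>K. w k * \<alpha> s k) * v s i + (\<Sum>k\<in>K. w k * \<tau> k) * v (s - 1) i)"
      unfolding sum_distrib_right sum_distrib_left sum.distrib[symmetric]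
      by (intro sum.cong) (simp_all add: algebra_simps)
  qed
  finally show ?thesis .
qed

lemma delta_apply:
  assumes "adapted p I J" "i \<in> I" "\<And>j. j \<in> J \<Longrightarrow> x j = (\<Sum>s\<in>{p..n}. c s * u s j)"
  shows "(\<Sum>j\<in>J. slice \<delta> i j * x j) = (\<Sum>s\<in>{p..n}. (c s * (\<Sum>k\<in>K. \<delta> k * \<alpha> s k)) * v s i)"
  using slice_apply[OF assms, of \<delta>] by (simp add: delta_tau mult.assoc)

text \<open>The weights \<open>\<nu>\<close> cancel the diagonal and leave the shift from
  \<open>u s\<close> to \<open>v (s - 1)\<close>; its term at \<open>p\<close> drops since
  \<open>v (p - 1)\<close> vanishes on \<open>I\<close>.\<close>

lemma nu_apply:
  assumes "adapted p I J" "1 \<le> p" "i \<in> I" "\<And>j. j \<in> J \<Longrightarrow> x j = (\<Sum>s\<in>{p..n}. c s * u s j)"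
  shows "(\<Sum>j\<in>J. slice \<nu> i j * x j) = (\<Sum>s\<in>{p..n}. (if s < n then c (Suc s) else 0) * v s i)"
proof -
  have "(\<Sum>j\<in>J. slice \<nu> i j * x j) = (\<Sum>s\<in>{p..n}. c s * v (s - 1) i)"
    using slice_apply[OF assms(1,3,4), of \<nu>] assms(2) by (simp add: nu_tau nu_alpha)
  also have "\<dots> = (\<Sum>s\<in>{p<..n}. c s * v (s - 1) i)"
    using assms(1,3) by (intro sum.mono_neutral_right) (auto simp: adapted_def)
  also have "\<dots> = (\<Sum>s\<in>{p..<n}. c (Suc s) * v s i)"
    by (rule sum.reindex_bij_witness[of _ Suc "\<lambda>s. s - 1"]) auto
  also have "\<dots> = (\<Sum>s\<in>{p..n}. (if s < n then c (Suc s) else 0) * v s i)"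
    by (intro sum.mono_neutral_cong_left) auto
  finally show ?thesis .
qed

text \<open>In the bases \<open>u\<close> and \<open>v\<close> the combination with weights
  \<open>\<delta>\<close> is diagonal with nonzero entries.\<close>

lemma delta_injective:
  assumes ad: "adapted p I J" "1 \<le> p"
    and 0: "\<And>i. i \<in> I \<Longrightarrow> (\<Sum>j\<in>J. slice \<delta> i j * x j) = 0" and j: "j \<in> J"
  shows "x j = 0"
proof -
  obtain c where c: "\<And>j. j \<in> J \<Longrightarrow> x j = (\<Sum>s\<in>{p..n}. c s * u s j)"
    using indep_family_spans[of "{p..n}" u J x] ad by (auto simp: adapted_def)
  have "c s = 0" if s: "s \<in> {p..n}" for s
  proof -
    have "(\<Sum>s\<in>{p..n}. (c s * (\<Sum>k\<in>K. \<delta> k * \<alpha> s k)) * v s i) = 0" if "i \<in> I" for i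
      using 0[OF that] delta_apply[OF ad(1) that c] by simp
    then have "c s * (\<Sum>k\<in>K. \<delta> k * \<alpha> s k) = 0"
      using indep_familyD[of "{p..n}" v I "\<lambda>s. c s * (\<Sum>k\<in>K. \<delta> k * \<alpha> s k)"] ad s
      by (auto simp: adapted_def)
    with delta_alpha[of s] s ad show ?thesis by simp
  qed
  with c[OF j] show ?thesis by simp
qed

text \<open>Let \<open>N\<close> and \<open>D\<close> be the combinations with weights
  \<open>\<nu>\<close> and \<open>\<delta>\<close>. If the support \<open>J'\<close> of
  \<open>u p\<close> had two elements, some vector supported on \<open>J'\<close> would not be a
  multiple of \<open>u p\<close>. Applying \<open>N\<close> and then the inverse of \<open>D\<close>
  stays inside \<open>J'\<close> and lowers the top index in the \<open>u\<close> expansion, until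
  \<open>functional\<close> gives a contradiction at \<open>Suc p\<close>.\<close>

lemma first_vectors_coordinate:
  assumes ad: "adapted p I J" and p: "1 \<le> p" "p \<le> n"
  obtains i0 j0 where "i0 \<in> I" "j0 \<in> J"
    "\<And>i. i \<in> I \<Longrightarrow> v p i \<noteq> 0 \<longleftrightarrow> i = i0" "\<And>j. j \<in> J \<Longrightarrow> u p j \<noteq> 0 \<longleftrightarrow> j = j0"
proof -
  define I' where "I' = {i\<in>I. v p i \<noteq> 0}"
  define J' where "J' = {j\<in>J. u p j \<noteq> 0}"
  have fin: "finite I" "finite J" "finite I'" "finite J'"
    using ad by (auto simp: adapted_def I'_def J'_def)
  have indep: "indep_family {p..n} u J" "indep_family {p..n} v I"
    using ad by (auto simp: adapted_def)
  have rel: "(\<Sum>j\<in>J. a i j k * u p j) = \<alpha> p k * v p i" if "i \<in> I" "k \<in> K" for i k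
    using ad p that by (simp add: adapted_def)
  have entry: "a i j k * u p j = \<alpha> p k * v p i"
    if "i \<in> I" "k \<in> K" "j \<in> J" "a i j k \<noteq> 0" for i j k
    using rel[OF that(1,2)] row_sum[OF fin(2) that(3,4)] by simp
  have ex_entry: "\<exists>j\<in>J'. a i j k \<noteq> 0" if "i \<in> I'" "k \<in> K" "\<alpha> p k \<noteq> 0" for i k
  proof -
    have "(\<Sum>j\<in>J. a i j k * u p j) \<noteq> 0"
      using rel[of i k] that by (simp add: I'_def)
    then obtain j where "j \<in> J" "a i j k * u p j \<noteq> 0"
      by (meson sum.neutral)
    then show ?thesis by (auto simp: J'_def)
  qed
  have "I' \<noteq> {}"
  proof
    assume "I' = {}"
    then have "(\<Sum>s\<in>{p..n}. (if s = p then 1 else 0) * v s i) = 0" if "i \<in> I" for i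
      using that by (intro sum.neutral) (auto simp: I'_def)
    from indep_familyD[OF indep(2) this, of p] p show False by simp
  qed
  have inside: "(\<Sum>j\<in>J. slice w i j * x j) = (\<Sum>j\<in>J'. slice w i j * x j)"
    if "\<And>j. j \<in> J - J' \<Longrightarrow> x j = 0" for w i x
    using that fin by (intro sum.mono_neutral_right) (auto simp: J'_def)
  \<comment> \<open>A nonzero entry in a column of \<open>J'\<close> makes \<open>v p i\<close>
    nonzero by \<open>entry\<close>.\<close>
  have outside: "slice w i j = 0" if "i \<in> I - I'" "j \<in> J'" for w i j
  proof -
    have "a i j k = 0" if "k \<in> K" for k
      using entry[of i k j] \<open>i \<in> I - I'\<close> \<open>j \<in> J'\<close> that by (auto simp: I'_def J'_def)
    then show ?thesis by (simp add: slice_def)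
  qed
  \<comment> \<open>A relation between these columns, extended by zero to \<open>J\<close>, lies in
    the kernel of an injective map.\<close>
  have delta_indep: "indep_family J' (\<lambda>j i. slice \<delta> i j) I'"
    unfolding indep_family_def
  proof (intro allI impI ballI)
    fix c j assume c: "\<forall>i\<in>I'. (\<Sum>j\<in>J'. c j * slice \<delta> i j) = 0" and j: "j \<in> J'"
    define x where "x j = (if j \<in> J' then c j else 0)" for j
    have "(\<Sum>j\<in>J. slice \<delta> i j * x j) = 0" if "i \<in> I" for i
    proof -
      have "(\<Sum>j\<in>J. slice \<delta> i j * x j) = (\<Sum>j\<in>J'. c j * slice \<delta> i j)"
        by (subst inside) (auto simp: x_def mult.commute intro!: sum.cong)
      also have "\<dots> = 0"
        using c outside that by (cases "i \<in> I'") auto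
      finally show ?thesis .
    qed
    from delta_injective[OF ad p(1) this, of j] j show "c j = 0"
      by (auto simp: x_def J'_def)
  qed
  then have le: "card J' \<le> card I'"
    using indep_family_card_le fin by blast
  \<comment> \<open>By \<open>free_i\<close> two rows cannot share a column of slice
    \<open>k\<close>, so a choice of nonzero entries is injective; \<open>le\<close> makes it a
    bijection.\<close>
  have match: "\<exists>g. bij_betw g I' J' \<and> (\<forall>i\<in>I'. a i (g i) k \<noteq> 0)"
    if k: "k \<in> K" "\<alpha> p k \<noteq> 0" for k
  proof -
    from ex_entry[OF _ k] obtain g where g: "\<And>i. i \<in> I' \<Longrightarrow> g i \<in> J' \<and> a i (g i) k \<noteq> 0"
      by metis
    then have inj: "inj_on g I'"
      using free_i by (metis inj_onI)
    have "g ` I' \<subseteq> J'" using g by blast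
    then have "g ` I' = J'"
      using le inj fin(4) by (metis card_image card_mono card_subset_eq le_antisym)
    with g inj show ?thesis by (auto simp: bij_betw_def)
  qed
  obtain k0 where "k0 \<in> K" "\<alpha> p k0 \<noteq> 0"
  proof (rule ccontr)
    assume "\<not> thesis"
    then have "(\<Sum>k\<in>K. \<delta> k * \<alpha> p k) = 0"
      using that by (intro sum.neutral) auto
    with delta_alpha[of p] p show False by simp
  qed
  from match[OF this] have card_eq: "card J' = card I'"
    by (auto dest: bij_betw_same_card)

  text \<open>On \<open>J'\<close> and \<open>I'\<close> slice \<open>k\<close> is \<open>\<alpha> p k\<close> times a permutation matrix with rescaled rows
    and columns, so it multiplies the sum of the rescaled coordinates by \<open>\<alpha> p k\<close>.\<close>
  have functional: "(\<Sum>i\<in>I'. (\<Sum>j\<in>J. slice w i j * x j) / v p i) =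
      (\<Sum>k\<in>K. w k * \<alpha> p k) * (\<Sum>j\<in>J'. x j / u p j)"
    if x: "\<And>j. j \<in> J - J' \<Longrightarrow> x j = 0" for w x
  proof -
    have each: "(\<Sum>i\<in>I'. (\<Sum>j\<in>J. a i j k * x j) / v p i) = \<alpha> p k * (\<Sum>j\<in>J'. x j / u p j)"
      if k: "k \<in> K" for k
    proof (cases "\<alpha> p k = 0")
      case True
      then have "a i j k * x j = 0" if "i \<in> I'" "j \<in> J" for i j
        using entry[of i k j] x[of j] k that by (cases "j \<in> J'") (auto simp: I'_def J'_def)
      then have "(\<Sum>j\<in>J. a i j k * x j) = 0" if "i \<in> I'" for i
        using that by (intro sum.neutral) auto
      with True show ?thesis by simp
    next
      case False
      with match k obtain g where g: "bij_betw g I' J'" "\<And>i. i \<in> I' \<Longrightarrow> a i (g i) k \<noteq> 0"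
        by blast
      have "(\<Sum>j\<in>J. a i j k * x j) / v p i = \<alpha> p k * (x (g i) / u p (g i))" if i: "i \<in> I'" for i
      proof -
        have gi: "g i \<in> J" "u p (g i) \<noteq> 0" "i \<in> I" "v p i \<noteq> 0"
          using bij_betwE[OF g(1)] i by (auto simp: J'_def I'_def)
        have "a i (g i) k = \<alpha> p k * v p i / u p (g i)"
          using entry[OF gi(3) k gi(1) g(2)[OF i]] gi(2) by (simp add: eq_divide_eq)
        then show ?thesis
          using row_sum[OF fin(2) gi(1) g(2)[OF i], of x] gi(4) by simp
      qed
      then show ?thesis
        unfolding sum_distrib_left sum.reindex_bij_betw[OF g(1), symmetric]
        by (intro sum.cong) auto
    qed
    have "(\<Sum>i\<in>I'. (\<Sum>j\<in>J. slice w i j * x j) / v p i) =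
        (\<Sum>i\<in>I'. \<Sum>k\<in>K. w k * ((\<Sum>j\<in>J. a i j k * x j) / v p i))"
      by (simp only: slice_sum sum_divide_distrib[where A = K] times_divide_eq_right)
    also have "\<dots> = (\<Sum>k\<in>K. w k * (\<Sum>i\<in>I'. (\<Sum>j\<in>J. a i j k * x j) / v p i))"
      unfolding sum_distrib_left[where A = I'] by (rule sum.swap)
    also have "\<dots> = (\<Sum>k\<in>K. w k * \<alpha> p k * (\<Sum>j\<in>J'. x j / u p j))"
      using each by (intro sum.cong) (simp_all add: mult.assoc)
    finally show ?thesis by (simp only: sum_distrib_right[where A = K])
  qed

  \<comment> \<open>\<open>q\<close> is the top index in the expansion of a vector supported on
    \<open>J'\<close>; descent shows that it cannot exceed \<open>p\<close>.\<close>
  have only_first: False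
    if "\<And>j. j \<in> J - J' \<Longrightarrow> (\<Sum>s\<in>{p..n}. c s * u s j) = 0" "c q \<noteq> 0"
      "\<And>s. q < s \<Longrightarrow> s \<le> n \<Longrightarrow> c s = 0" "p < q" "q \<le> n" for c q
    using that
  proof (induction q arbitrary: c rule: less_induct)
    case (less q)
    define x where "x j = (\<Sum>s\<in>{p..n}. c s * u s j)" for j
    define c' where "c' s = (if s < n then c (Suc s) else 0)" for s
    have Nx: "(\<Sum>j\<in>J. slice \<nu> i j * x j) = (\<Sum>s\<in>{p..n}. c' s * v s i)" if "i \<in> I" for i
      unfolding c'_def by (rule nu_apply[OF ad p(1) that]) (simp add: x_def)
    have x0: "x j = 0" if "j \<in> J - J'" for j
      using less.prems(1)[OF that] by (simp add: x_def)
    have x_sum: "(\<Sum>j\<in>J. slice w i j * x j) = (\<Sum>j\<in>J'. slice w i j * x j)" for w i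
      by (rule inside) (rule x0)
    show False
    proof (cases "q = Suc p")
      case True
      have c'0: "c' s = 0" if "s \<in> {p..n} - {p}" for s
        using less.prems(3)[of "Suc s"] that True by (auto simp: c'_def)
      have "(\<Sum>s\<in>{p..n}. c' s * v s i) = c q * v p i" for i
      proof -
        have "(\<Sum>s\<in>{p..n} - {p}. c' s * v s i) = 0"
          using c'0 by (intro sum.neutral) auto
        moreover have "c' p = c q"
          using True less.prems by (simp add: c'_def)
        ultimately show ?thesis
          using sum.remove[of "{p..n}" p "\<lambda>s. c' s * v s i"] p by simp
      qed
      \<comment> \<open>The image under \<open>\<nu>\<close> is \<open>c q\<close> times
        \<open>v p\<close>, so this sum is \<open>c q\<close> times the size of \<open>I'\<close>,
        nonzero in characteristic 0, whereas \<open>functional\<close> and \<open>nu_alpha\<close>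
        give 0.\<close>
      then have "(\<Sum>i\<in>I'. (\<Sum>j\<in>J. slice \<nu> i j * x j) / v p i) = (\<Sum>i\<in>I'. c q)"
        using Nx by (intro sum.cong) (auto simp: I'_def)
      moreover have "(\<Sum>i\<in>I'. (\<Sum>j\<in>J. slice \<nu> i j * x j) / v p i) = 0"
        using functional[where w = \<nu> and x = x, OF x0] nu_alpha[of p] p by simp
      ultimately show False
        using less.prems(2) fin(3) \<open>I' \<noteq> {}\<close> by simp
    next
      case False
      \<comment> \<open>On \<open>I'\<close> and \<open>J'\<close> the combination
        \<open>\<delta>\<close> is square with independent columns, so the image of \<open>x\<close>
        under \<open>\<nu>\<close> has a preimage there; on rows outside \<open>I'\<close> both
        sides vanish by \<open>outside\<close>.\<close>
      obtain y' where y': "\<And>i. i \<in> I' \<Longrightarrow>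
          (\<Sum>j\<in>J. slice \<nu> i j * x j) = (\<Sum>j\<in>J'. y' j * slice \<delta> i j)"
        using indep_family_spans[OF delta_indep fin(4) fin(3) card_eq,
            of "\<lambda>i. \<Sum>j\<in>J. slice \<nu> i j * x j"] by blast
      define y where "y j = (if j \<in> J' then y' j else 0)" for j
      have y_sum: "(\<Sum>j\<in>J. slice \<delta> i j * y j) = (\<Sum>j\<in>J'. y' j * slice \<delta> i j)" for i
        by (subst inside) (auto simp: y_def mult.commute intro!: sum.cong)
      have Dy: "(\<Sum>j\<in>J. slice \<delta> i j * y j) = (\<Sum>j\<in>J. slice \<nu> i j * x j)" if "i \<in> I" for i
      proof (cases "i \<in> I'")
        case True
        with y' show ?thesis unfolding y_sum by simp
      next
        case False
        with outside that show ?thesis unfolding y_sum x_sum by simp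
      qed
      obtain e where e: "\<And>j. j \<in> J \<Longrightarrow> y j = (\<Sum>s\<in>{p..n}. e s * u s j)"
        using indep_family_spans[of "{p..n}" u J y] ad by (auto simp: adapted_def)
      \<comment> \<open>For \<open>s < n\<close>, \<open>e s\<close> is \<open>c (Suc s)\<close>
        divided by a nonzero diagonal entry, so the top index drops to \<open>q - 1\<close>.\<close>
      have e_eq: "e s * (\<Sum>k\<in>K. \<delta> k * \<alpha> s k) = c' s" if "s \<in> {p..n}" for s
        by (rule indep_family_eqD[OF indep(2) _ that,
              of "\<lambda>s. e s * (\<Sum>k\<in>K. \<delta> k * \<alpha> s k)" c'])
          (use delta_apply[OF ad _ e] Dy Nx in simp)
      show False
      proof (rule less.IH[of "q - 1" e])
        show "q - 1 < q" "p < q - 1" "q - 1 \<le> n"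
          using less.prems False by auto
        show "(\<Sum>s\<in>{p..n}. e s * u s j) = 0" if "j \<in> J - J'" for j
          using e[of j] that by (simp add: y_def)
        have "q - 1 \<in> {p..n}" "q - 1 < n" "Suc (q - 1) = q"
          using less.prems(4,5) by auto
        then show "e (q - 1) \<noteq> 0"
          using e_eq[of "q - 1"] less.prems(2) by (auto simp: c'_def simp del: One_nat_def)
        show "e s = 0" if "q - 1 < s" "s \<le> n" for s
        proof -
          have "c' s = 0"
            using that less.prems(3)[of "Suc s"] by (auto simp: c'_def)
          moreover have "s \<in> {p..n}" using that less.prems(4) by auto
          ultimately show ?thesis
            using e_eq[of s] delta_alpha[of s] p by auto
        qed
      qed
    qed
  qed

  obtain j0 where j0: "j0 \<in> J'"
    using card_eq \<open>I' \<noteq> {}\<close> fin by (metis card_eq_0_iff equals0I)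
  have J'_single: "j = j0" if "j \<in> J'" for j
  proof (rule ccontr)
    assume "j \<noteq> j0"
    \<comment> \<open>This coordinate vector is supported on \<open>J'\<close>, so by
      \<open>only_first\<close> it is a multiple of \<open>u p\<close>, although it vanishes at
      \<open>j\<close>.\<close>
    define x where "x j = (if j = j0 then 1 else 0 :: 'f)" for j
    obtain c where c: "\<And>j. j \<in> J \<Longrightarrow> x j = (\<Sum>s\<in>{p..n}. c s * u s j)"
      using indep_family_spans[of "{p..n}" u J x] ad by (auto simp: adapted_def)
    have higher: "c s = 0" if "s \<in> {p<..n}" for s
    proof (rule ccontr)
      assume "c s \<noteq> 0"
      define Q where "Q = {s\<in>{p<..n}. c s \<noteq> 0}"
      have Q: "finite Q" "Q \<noteq> {}" using that \<open>c s \<noteq> 0\<close> by (auto simp: Q_def)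
      have "Max Q \<in> Q" using Q by simp
      show False
      proof (rule only_first[of c "Max Q"])
        show "c (Max Q) \<noteq> 0" "p < Max Q" "Max Q \<le> n"
          using \<open>Max Q \<in> Q\<close> by (auto simp: Q_def)
        show "c s = 0" if "Max Q < s" "s \<le> n" for s
        proof (rule ccontr)
          assume "c s \<noteq> 0"
          with that \<open>p < Max Q\<close> have "s \<in> Q" by (auto simp: Q_def)
          from Max_ge[OF Q(1) this] that show False by simp
        qed
        show "(\<Sum>s\<in>{p..n}. c s * u s j) = 0" if "j \<in> J - J'" for j
        proof -
          have "j \<noteq> j0" using that j0 by blast
          then show ?thesis using c[of j] that by (simp add: x_def)
        qed
      qed
    qed
    have "x j = c p * u p j" if "j \<in> J" for j
    proof -
      have "(\<Sum>s\<in>{p..n} - {p}. c s * u s j) = 0"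
        using higher by (intro sum.neutral) auto
      then show ?thesis
        using c[OF that] sum.remove[of "{p..n}" p "\<lambda>s. c s * u s j"] p by simp
    qed
    from this[of j] this[of j0] \<open>j \<in> J'\<close> j0 \<open>j \<noteq> j0\<close> show False
      by (auto simp: x_def J'_def)
  qed
  have "J' = {j0}" using j0 J'_single by blast
  then have "card I' = 1" using card_eq by simp
  then obtain i0 where "I' = {i0}" by (rule card_1_singletonE)
  with \<open>J' = {j0}\<close> show ?thesis
    by (intro that[of i0 j0]) (auto simp: I'_def J'_def)
qed

text \<open>As \<open>u p\<close> and \<open>v p\<close> are multiples of coordinate vectors on
  \<open>J\<close> and \<open>I\<close>, column \<open>j0\<close> of every slice vanishes on
  \<open>I\<close> outside row \<open>i0\<close>. Deleting this row and column keeps the other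
  relations, and the entry at \<open>i0\<close>, \<open>j0\<close> is \<open>\<alpha> p k\<close> up
  to a nonzero factor independent of \<open>k\<close>.\<close>

lemma adapted_remove:
  assumes ad: "adapted p I J" and p: "1 \<le> p" "p \<le> n" and i0: "i0 \<in> I" and j0: "j0 \<in> J"
    and v: "\<And>i. i \<in> I \<Longrightarrow> v p i \<noteq> 0 \<longleftrightarrow> i = i0" and u: "\<And>j. j \<in> J \<Longrightarrow> u p j \<noteq> 0 \<longleftrightarrow> j = j0"
  shows "adapted (Suc p) (I - {i0}) (J - {j0})"
    and "\<And>k. k \<in> K \<Longrightarrow> \<alpha> p k \<noteq> 0 \<Longrightarrow> a i0 j0 k \<noteq> 0"
proof -
  have fin: "finite I" "finite J" using ad by (auto simp: adapted_def)
  have first: "a i j0 k * u p j0 = \<alpha> p k * v p i" if "i \<in> I" "k \<in> K" for i k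
  proof -
    have "(\<Sum>j\<in>J. a i j k * u p j) = \<alpha> p k * v p i"
      using ad p that by (simp add: adapted_def)
    moreover have "(\<Sum>j\<in>J - {j0}. a i j k * u p j) = 0"
      using u by (intro sum.neutral) auto
    ultimately show ?thesis
      using sum.remove[OF fin(2) j0, of "\<lambda>j. a i j k * u p j"] by simp
  qed
  from first[OF i0] v[OF i0] show "a i0 j0 k \<noteq> 0" if "k \<in> K" "\<alpha> p k \<noteq> 0" for k
    using that by fastforce
  have column: "a i j0 k = 0" if "i \<in> I - {i0}" "k \<in> K" for i k
    using first[of i k] v[of i] u[OF j0] that by auto
  have reduce: "indep_family {Suc p..n} w (X - {x0})"
    if w: "indep_family {p..n} w X" and x0: "x0 \<in> X"
      and wx: "\<And>x. x \<in> X \<Longrightarrow> w p x \<noteq> 0 \<longleftrightarrow> x = x0" for w :: "nat \<Rightarrow> 'z \<Rightarrow> 'f" and X x0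
    unfolding indep_family_def
  proof (intro allI impI ballI)
    fix c s
    assume c: "\<forall>x\<in>X - {x0}. (\<Sum>s\<in>{Suc p..n}. c s * w s x) = 0" and s: "s \<in> {Suc p..n}"
    \<comment> \<open>A relation away from \<open>x0\<close> is completed by the multiple of
      \<open>w p\<close> that corrects its value at \<open>x0\<close>; elsewhere \<open>w p\<close>
      vanishes.\<close>
    define t where "t = (\<Sum>s\<in>{Suc p..n}. c s * w s x0) / w p x0"
    define c' where "c' = c(p := - t)"
    have "(\<Sum>s\<in>{p..n}. c' s * w s x) = 0" if "x \<in> X" for x
    proof -
      have "(\<Sum>s\<in>{p..n}. c' s * w s x) = c' p * w p x + (\<Sum>s\<in>{Suc p..n}. c' s * w s x)"
        using p by (simp add: sum.atLeast_Suc_atMost)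
      also have "(\<Sum>s\<in>{Suc p..n}. c' s * w s x) = (\<Sum>s\<in>{Suc p..n}. c s * w s x)"
        by (intro sum.cong) (auto simp: c'_def)
      also have "c' p * w p x + (\<Sum>s\<in>{Suc p..n}. c s * w s x) = 0"
      proof (cases "x = x0")
        case True
        with wx[OF x0] show ?thesis by (simp add: c'_def t_def)
      next
        case False
        with wx[OF that] that c show ?thesis by simp
      qed
      finally show ?thesis .
    qed
    from indep_familyD[OF w this, of s] s show "c s = 0"
      by (simp add: c'_def)
  qed
  show "adapted (Suc p) (I - {i0}) (J - {j0})"
    unfolding adapted_def
  proof (intro conjI ballI)
    have "indep_family {p..n} u J" "indep_family {p..n} v I"
      using ad by (simp_all add: adapted_def)
    then show "indep_family {Suc p..n} u (J - {j0})" "indep_family {Suc p..n} v (I - {i0})"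
      by (simp_all add: reduce j0 u i0 v)
    show "v (Suc p - 1) i = 0" if "i \<in> I - {i0}" for i
      using v that by auto
    show "(\<Sum>j\<in>J - {j0}. a i j k * u s j) = \<alpha> s k * v s i + \<tau> k * v (s - 1) i"
      if "i \<in> I - {i0}" "s \<in> {Suc p..n}" "k \<in> K" for i s k
    proof -
      have "(\<Sum>j\<in>J - {j0}. a i j k * u s j) = (\<Sum>j\<in>J. a i j k * u s j)"
        using sum.remove[OF fin(2) j0, of "\<lambda>j. a i j k * u s j"] column that by simp
      also have "\<dots> = \<alpha> s k * v s i + \<tau> k * v (s - 1) i"
        using ad that by (simp add: adapted_def)
      finally show ?thesis .
    qed
  qed (use ad i0 j0 in \<open>auto simp: adapted_def\<close>)
qed

text \<open>When the descent reaches \<open>s\<close>, the form \<open>\<alpha> s\<close> is read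
  off, up to a scalar, at a single position \<open>i0\<close>, \<open>j0\<close>, where
  \<open>free_k\<close> allows only one nonzero slice.\<close>

theorem diagonal_form_single_coordinate:
  assumes "adapted p I J" "1 \<le> p" "s \<in> {p..n}"
    and "k \<in> K" "k' \<in> K" "\<alpha> s k \<noteq> 0" "\<alpha> s k' \<noteq> 0"
  shows "k = k'"
  using assms(1-3)
proof (induction "n - p" arbitrary: p I J rule: less_induct)
  case less
  then have "p \<le> n" by simp
  show ?case
  proof (rule first_vectors_coordinate[OF less.prems(1,2) \<open>p \<le> n\<close>])
    fix i0 j0
    assume "i0 \<in> I" "j0 \<in> J" "\<And>i. i \<in> I \<Longrightarrow> v p i \<noteq> 0 \<longleftrightarrow> i = i0" "\<And>j. j \<in> J \<Longrightarrow> u p j \<noteq> 0 \<longleftrightarrow> j = j0"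
    note remove = adapted_remove[OF less.prems(1,2) \<open>p \<le> n\<close> this]
    show "k = k'"
    proof (cases "s = p")
      case True
      with remove(2)[of k] remove(2)[of k'] assms(4-7) show ?thesis by (blast intro: free_k)
    next
      case False
      with less.prems have "s \<in> {Suc p..n}" "n - Suc p < n - p" by auto
      with less.hyps[OF _ remove(1)] show ?thesis by simp
    qed
  qed
qed

end

section \<open>The special tensor\<close>

lemma sum_upto_shift: "(\<Sum>k = 0..<n. f k) = (\<Sum>k = 1..n. f (k - 1))" for n :: nat
  by (rule sum.reindex_bij_witness[of _ "\<lambda>k. k - 1" Suc]) auto

lemma index_mult_shift:
  assumes "A \<in> carrier_mat n n" "B \<in> carrier_mat n n" "i \<in> {1..n}" "j \<in> {1..n}"
  shows "(A * B) $$ (i - 1, j - 1) = (\<Sum>k = 1..n. A $$ (i - 1, k - 1) * B $$ (k - 1, j - 1))"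
proof -
  have "(A * B) $$ (i - 1, j - 1) = (\<Sum>k = 0..<n. A $$ (i - 1, k) * B $$ (k, j - 1))"
    using assms by (auto simp: scalar_prod_def)
  then show ?thesis by (simp only: sum_upto_shift)
qed

lemma GL_iff_det: "A \<in> GL n \<longleftrightarrow> A \<in> carrier_mat n n \<and> det A \<noteq> 0"
proof (cases "A \<in> carrier_mat n n")
  case A: True
  show ?thesis
  proof
    assume "A \<in> GL n"
    then obtain B where B: "A * B = 1\<^sub>m n" "B * A = 1\<^sub>m (dim_row B)"
      using A by (auto simp: GL_def invertible_mat_def inverts_mat_def)
    have "dim_col B = n" using arg_cong[OF B(1), of dim_col] by simp
    moreover have "dim_row B = n" using arg_cong[OF B(2), of dim_col] A by simp
    ultimately have "B \<in> carrier_mat n n" by auto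
    from det_mult[OF A this] B(1) show "A \<in> carrier_mat n n \<and> det A \<noteq> 0"
      using A by auto
  next
    assume "A \<in> carrier_mat n n \<and> det A \<noteq> 0"
    then obtain B where B: "B \<in> carrier_mat n n" "B * A = 1\<^sub>m n" "A * B = 1\<^sub>m n"
      using det_non_zero_imp_unit[OF A, of "()"] by (auto simp: Units_def ring_mat_def)
    with A show "A \<in> GL n"
      by (auto simp: GL_def invertible_mat_def inverts_mat_def intro!: exI[of _ B])
  qed
qed (simp add: GL_def)

lemma GL_mult: "A \<in> GL n \<Longrightarrow> B \<in> GL n \<Longrightarrow> A * B \<in> GL n"
  by (auto simp: GL_iff_det det_mult)

lemma GL_left_inverse_entries:
  assumes "A \<in> GL n"
  shows "\<exists>B. \<forall>i\<in>{1..n}. \<forall>j\<in>{1..n}.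
    (\<Sum>k = 1..n. B i k * A $$ (k - 1, j - 1)) = (if i = j then 1 else 0)"
proof -
  have A: "A \<in> carrier_mat n n" "det A \<noteq> 0" using assms by (auto simp: GL_iff_det)
  then obtain B where B: "B \<in> carrier_mat n n" "B * A = 1\<^sub>m n"
    using det_non_zero_imp_unit[OF A, of "()"] by (auto simp: Units_def ring_mat_def)
  have "(\<Sum>k = 1..n. B $$ (i - 1, k - 1) * A $$ (k - 1, j - 1)) = (if i = j then 1 else 0)"
    if ij: "i \<in> {1..n}" "j \<in> {1..n}" for i j
  proof -
    have "i - 1 < n" "j - 1 < n" "i - 1 = j - 1 \<longleftrightarrow> i = j" using ij by auto
    then show ?thesis
      unfolding index_mult_shift[OF B(1) A(1) ij, symmetric] by (simp add: B)
  qed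
  then show ?thesis by (intro exI[of _ "\<lambda>i j. B $$ (i - 1, j - 1)"]) blast
qed

text \<open>Pairing a relation with \<open>w t\<close> isolates the coefficient of
  \<open>t\<close>.\<close>

lemma indep_family_dual:
  assumes fin: "finite S"
    and dual: "\<And>s t. s \<in> S \<Longrightarrow> t \<in> S \<Longrightarrow> (\<Sum>j\<in>J. u s j * w t j) = (if s = t then 1 else 0)"
  shows "indep_family S u J"
  unfolding indep_family_def
proof (intro allI impI ballI)
  fix c t assume c: "\<forall>j\<in>J. (\<Sum>s\<in>S. c s * u s j) = 0" and t: "t \<in> S"
  have "c t = (\<Sum>s\<in>S. if s = t then c s else 0)"
    using fin t by simp
  also have "\<dots> = (\<Sum>s\<in>S. c s * (\<Sum>j\<in>J. u s j * w t j))"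
    using dual t by (intro sum.cong) simp_all
  also have "\<dots> = (\<Sum>s\<in>S. \<Sum>j\<in>J. c s * u s j * w t j)"
    by (simp add: sum_distrib_left mult.assoc)
  also have "\<dots> = (\<Sum>j\<in>J. (\<Sum>s\<in>S. c s * u s j) * w t j)"
    unfolding sum_distrib_right by (rule sum.swap)
  also have "\<dots> = 0" using c by simp
  finally show "c t = 0" .
qed

section \<open>The special tensor in transformed coordinates\<close>

lemma act_outside_cube: "p \<notin> cube n \<Longrightarrow> act n A B C T p = 0"
  by (cases p) (auto simp: act_def)

text \<open>A vector dual to column \<open>t\<close> of \<open>B\<close> and orthogonal to the
  others undoes the change of the second basis and selects second index \<open>t\<close>.\<close>

lemma act_contract_second:
  assumes "i \<in> {1..n}" "k \<in> {1..n}" "t \<in> {1..n}"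
    and u: "\<And>j'. j' \<in> {1..n} \<Longrightarrow> (\<Sum>j = 1..n. B $$ (j - 1, j' - 1) * u j) = (if j' = t then 1 else 0)"
  shows "(\<Sum>j = 1..n. act n A B C T (i, j, k) * u j) =
    (\<Sum>i' = 1..n. \<Sum>k' = 1..n. A $$ (i - 1, i' - 1) * C $$ (k - 1, k' - 1) * T (i', t, k'))"
proof -
  have "(\<Sum>j = 1..n. act n A B C T (i, j, k) * u j) =
      (\<Sum>j = 1..n. \<Sum>i' = 1..n. \<Sum>j' = 1..n. \<Sum>k' = 1..n.
        A $$ (i - 1, i' - 1) * C $$ (k - 1, k' - 1) * T (i', j', k') * (B $$ (j - 1, j' - 1) * u j))"
  proof (rule sum.cong[OF refl])
    fix j assume "j \<in> {1..n}"
    then have act: "act n A B C T (i, j, k) = (\<Sum>i' = 1..n. \<Sum>j' = 1..n. \<Sum>k' = 1..n.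
        A $$ (i - 1, i' - 1) * B $$ (j - 1, j' - 1) * C $$ (k - 1, k' - 1) * T (i', j', k'))"
      using assms(1,2) by (auto simp: act_def cube_def)
    show "act n A B C T (i, j, k) * u j = (\<Sum>i' = 1..n. \<Sum>j' = 1..n. \<Sum>k' = 1..n.
        A $$ (i - 1, i' - 1) * C $$ (k - 1, k' - 1) * T (i', j', k') * (B $$ (j - 1, j' - 1) * u j))"
      unfolding act sum_distrib_right by (intro sum.cong refl) (simp only: mult_ac)
  qed
  also have "\<dots> = (\<Sum>i' = 1..n. \<Sum>j' = 1..n. \<Sum>k' = 1..n. \<Sum>j = 1..n.
        A $$ (i - 1, i' - 1) * C $$ (k - 1, k' - 1) * T (i', j', k') * (B $$ (j - 1, j' - 1) * u j))"
    by (rule trans[OF sum.swap], rule sum.cong[OF refl], rule trans[OF sum.swap],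
        rule sum.cong[OF refl], rule sum.swap)
  also have "\<dots> = (\<Sum>i' = 1..n. \<Sum>j' = 1..n. \<Sum>k' = 1..n.
        A $$ (i - 1, i' - 1) * C $$ (k - 1, k' - 1) * T (i', j', k') * (if j' = t then 1 else 0))"
    using u by (intro sum.cong refl) (simp add: sum_distrib_left[symmetric])
  also have "\<dots> = (\<Sum>i' = 1..n. \<Sum>k' = 1..n. \<Sum>j' = 1..n.
        if j' = t then A $$ (i - 1, i' - 1) * C $$ (k - 1, k' - 1) * T (i', j', k') else 0)"
    by (rule sum.cong[OF refl], rule trans[OF sum.swap], intro sum.cong) auto
  also have "\<dots> = (\<Sum>i' = 1..n. \<Sum>k' = 1..n. A $$ (i - 1, i' - 1) * C $$ (k - 1, k' - 1) * T (i', t, k'))"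
    using assms(3) by simp
  finally show ?thesis .
qed

text \<open>With the second index reversed, \<open>s\<close> numbers the columns of a bidiagonal
  pencil. The first term is its diagonal, present in all slices \<open>k < n\<close> if
  \<open>s = 1\<close> and only in slice \<open>n + 1 - s\<close> otherwise; the second is the shift
  in slice \<open>n\<close>.\<close>

lemma special_tensor_slice:
  assumes "s \<in> {1..n}" "i \<in> {1..n}" "k \<in> {1..n}"
  shows "special_tensor n (i, n + 1 - s, k) =
    (if i = s \<and> k < n \<and> (s = 1 \<or> k = n + 1 - s) then 1 else 0) + (if i + 1 = s \<and> k = n then 1 else 0)"
proof -
  have "(\<Sum>k' = 1..n - 1. basis_tensor 1 n k' (i, n + 1 - s, k)) =
      (\<Sum>k' = 1..n - 1. if k' = k then if i = 1 \<and> s = 1 then 1 else 0 else 0)"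
    using assms by (intro sum.cong) (auto simp: pure_tensor_def std_basis_def)
  moreover have "(\<Sum>i' = 2..n. basis_tensor i' (n + 1 - i') (n + 1 - i') (i, n + 1 - s, k)) =
      (\<Sum>i' = 2..n. if i' = i then if i = s \<and> k = n + 1 - s then 1 else 0 else 0)"
    using assms by (intro sum.cong) (auto simp: pure_tensor_def std_basis_def)
  moreover have "(\<Sum>i' = 1..n - 1. basis_tensor i' (n - i') n (i, n + 1 - s, k)) =
      (\<Sum>i' = 1..n - 1. if i' = i then if i + 1 = s \<and> k = n then 1 else 0 else 0)"
    using assms by (intro sum.cong) (auto simp: pure_tensor_def std_basis_def)
  ultimately show ?thesis
    using assms by (auto simp: special_tensor_def)
qed

text \<open>Each of the first \<open>n - 1\<close> columns of \<open>C\<close> would have a single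
  nonzero entry, in distinct rows. Their sum \<open>\<alpha> 1\<close> must have a single nonzero
  entry too, although \<open>n - 1\<close> is at least 2.\<close>

theorem special_tensor_not_free:
  assumes n: "n \<ge> 3"
  shows "\<not> free_tensor n (special_tensor n)"
proof
  assume "free_tensor n (special_tensor n)"
  then obtain A B C where GL: "A \<in> GL n" "B \<in> GL n" "C \<in> GL n"
    and free: "free_set (supp n (act n A B C (special_tensor n)))"
    by (auto simp: free_tensor_def)
  define a where "a i j k = act n A B C (special_tensor n) (i, j, k)" for i j k
  have mem: "(i, j, k) \<in> supp n (act n A B C (special_tensor n))" if "a i j k \<noteq> 0" for i j k
    using that act_outside_cube[of "(i, j, k)" n] by (auto simp: a_def supp_def)
  obtain Ai where "\<forall>i\<in>{1..n}. \<forall>j\<in>{1..n}.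
      (\<Sum>k = 1..n. Ai i k * A $$ (k - 1, j - 1)) = (if i = j then 1 else 0)"
    using GL_left_inverse_entries[OF GL(1)] by blast
  note Ai = this[rule_format]
  obtain Bi where "\<forall>i\<in>{1..n}. \<forall>j\<in>{1..n}.
      (\<Sum>k = 1..n. Bi i k * B $$ (k - 1, j - 1)) = (if i = j then 1 else 0)"
    using GL_left_inverse_entries[OF GL(2)] by blast
  note Bi = this[rule_format]
  obtain Ci where "\<forall>i\<in>{1..n}. \<forall>j\<in>{1..n}.
      (\<Sum>k = 1..n. Ci i k * C $$ (k - 1, j - 1)) = (if i = j then 1 else 0)"
    using GL_left_inverse_entries[OF GL(3)] by blast
  note Ci = this[rule_format]
  \<comment> \<open>\<open>u s\<close> is a row of the inverse of \<open>B\<close>,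
    \<open>v s\<close> a column of \<open>A\<close>; setting \<open>v 0\<close> to zero starts the
    superdiagonal.\<close>
  define u where "u s j = Bi (n + 1 - s) j" for s j
  define v where "v s i = (if s = 0 then 0 else A $$ (i - 1, s - 1))" for s i
  define \<alpha> where "\<alpha> s k =
    (if s = 1 then (\<Sum>k' = 1..n - 1. C $$ (k - 1, k' - 1)) else C $$ (k - 1, n - s))" for s k
  define \<tau> where "\<tau> k = C $$ (k - 1, n - 1)" for k
  \<comment> \<open>This functional is 1 on the first \<open>n - 1\<close> columns of
    \<open>C\<close> and 0 on the last, so it is \<open>n - 1\<close> on \<open>\<alpha> 1\<close>
    and 1 on the other diagonal forms.\<close>
  define \<delta> where "\<delta> k = (\<Sum>r = 1..n - 1. Ci r k)" for k
  define \<nu> where "\<nu> k = Ci n k" for k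
  have pair_delta: "(\<Sum>k = 1..n. \<delta> k * C $$ (k - 1, k' - 1)) = (if k' < n then 1 else 0)"
    if "k' \<in> {1..n}" for k'
  proof -
    have "(\<Sum>k = 1..n. \<delta> k * C $$ (k - 1, k' - 1)) =
        (\<Sum>r = 1..n - 1. \<Sum>k = 1..n. Ci r k * C $$ (k - 1, k' - 1))"
      unfolding \<delta>_def sum_distrib_right by (rule sum.swap)
    also have "\<dots> = (\<Sum>r = 1..n - 1. if r = k' then 1 else 0)"
      using that by (intro sum.cong refl Ci) auto
    finally show ?thesis using that by auto
  qed
  have pair_nu: "(\<Sum>k = 1..n. \<nu> k * C $$ (k - 1, k' - 1)) = (if k' = n then 1 else 0)"
    if "k' \<in> {1..n}" for k'
    unfolding \<nu>_def using Ci[of n k'] n that by auto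
  have pair_alpha: "(\<Sum>k = 1..n. w k * \<alpha> s k) =
      (if s = 1 then \<Sum>k' = 1..n - 1. \<Sum>k = 1..n. w k * C $$ (k - 1, k' - 1)
       else \<Sum>k = 1..n. w k * C $$ (k - 1, (n + 1 - s) - 1))" for w s
    unfolding \<alpha>_def by (auto simp: sum_distrib_left intro: sum.swap)

  interpret free_bidiagonal_pencil n "{1..n}" a u v \<alpha> \<tau> \<delta> \<nu>
  proof
    show "k = k'" if "a i j k \<noteq> 0" "a i j k' \<noteq> 0" for i j k k'
      using free mem[OF that(1)] mem[OF that(2)] unfolding free_set_def by fastforce
    show "j = j'" if "a i j k \<noteq> 0" "a i j' k \<noteq> 0" for i j k j'
      using free mem[OF that(1)] mem[OF that(2)] unfolding free_set_def by fastforce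
    show "i = i'" if "a i j k \<noteq> 0" "a i' j k \<noteq> 0" for i j k i'
      using free mem[OF that(1)] mem[OF that(2)] unfolding free_set_def by fastforce
    show "(\<Sum>k = 1..n. \<delta> k * \<alpha> s k) \<noteq> 0" if s: "s \<in> {1..n}" for s
    proof (cases "s = 1")
      case True
      have "(\<Sum>k = 1..n. \<delta> k * \<alpha> s k) = (\<Sum>k' = 1..n - 1. 1)"
        unfolding pair_alpha if_P[OF True]
      proof (rule sum.cong[OF refl])
        fix k' assume "k' \<in> {1..n - 1}"
        then show "(\<Sum>k = 1..n. \<delta> k * C $$ (k - 1, k' - 1)) = 1"
          using pair_delta[of k'] by auto
      qed
      with n show ?thesis by simp
    next
      case False
      then have "n + 1 - s \<in> {1..n}" "n + 1 - s < n" using s by auto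
      from pair_delta[OF this(1)] this(2) False show ?thesis
        unfolding pair_alpha by simp
    qed
    show "(\<Sum>k = 1..n. \<delta> k * \<tau> k) = 0"
      unfolding \<tau>_def using pair_delta[of n] n by simp
    show "(\<Sum>k = 1..n. \<nu> k * \<tau> k) = 1"
      unfolding \<tau>_def using pair_nu[of n] n by simp
    show "(\<Sum>k = 1..n. \<nu> k * \<alpha> s k) = 0" if s: "s \<in> {1..n}" for s
    proof (cases "s = 1")
      case True
      have "(\<Sum>k = 1..n. \<nu> k * \<alpha> s k) = (\<Sum>k' = 1..n - 1. 0)"
        unfolding pair_alpha if_P[OF True]
      proof (rule sum.cong[OF refl])
        fix k' assume "k' \<in> {1..n - 1}"
        then show "(\<Sum>k = 1..n. \<nu> k * C $$ (k - 1, k' - 1)) = 0"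
          using pair_nu[of k'] by auto
      qed
      then show ?thesis by simp
    next
      case False
      then have "n + 1 - s \<in> {1..n}" "n + 1 - s \<noteq> n" using s by auto
      from pair_nu[OF this(1)] this(2) False show ?thesis
        unfolding pair_alpha by simp
    qed
  qed simp

  have "adapted 1 {1..n} {1..n}"
    unfolding adapted_def
  proof (intro conjI ballI)
    show "indep_family {1..n} u {1..n}"
    proof (rule indep_family_dual[where w = "\<lambda>t j. B $$ (j - 1, (n + 1 - t) - 1)"])
      fix s t assume "s \<in> {1..n}" "t \<in> {1..n}"
      then have "n + 1 - s \<in> {1..n}" "n + 1 - t \<in> {1..n}" "n + 1 - s = n + 1 - t \<longleftrightarrow> s = t"
        by auto
      with Bi[OF this(1,2)]
      show "(\<Sum>j = 1..n. u s j * B $$ (j - 1, (n + 1 - t) - 1)) = (if s = t then 1 else 0)"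
        unfolding u_def by (simp only:)
    qed simp
    show "indep_family {1..n} v {1..n}"
    proof (rule indep_family_dual[where w = Ai])
      fix s t assume "s \<in> {1..n}" "t \<in> {1..n}"
      with Ai[of t s] show "(\<Sum>i = 1..n. v s i * Ai t i) = (if s = t then 1 else 0)"
        by (auto simp: v_def mult.commute)
    qed simp
    show "(\<Sum>j = 1..n. a i j k * u s j) = \<alpha> s k * v s i + \<tau> k * v (s - 1) i"
      if i: "i \<in> {1..n}" and s: "s \<in> {1..n}" and k: "k \<in> {1..n}" for i s k
    proof -
      have t: "n + 1 - s \<in> {1..n}" using s by auto
      have u_dual: "(\<Sum>j = 1..n. B $$ (j - 1, j' - 1) * u s j) = (if j' = n + 1 - s then 1 else 0)"
        if "j' \<in> {1..n}" for j'
        using Bi[OF t that] by (auto simp: u_def mult.commute)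
      have "(\<Sum>j = 1..n. a i j k * u s j) = (\<Sum>i' = 1..n. \<Sum>k' = 1..n.
          A $$ (i - 1, i' - 1) * C $$ (k - 1, k' - 1) * special_tensor n (i', n + 1 - s, k'))"
        unfolding a_def by (rule act_contract_second[OF i k t u_dual])
      also have "\<dots> = (\<Sum>i' = 1..n. (if i' = s then A $$ (i - 1, i' - 1) * \<alpha> s k else 0) +
          (if i' + 1 = s then A $$ (i - 1, i' - 1) * \<tau> k else 0))"
      proof (rule sum.cong[OF refl])
        fix i' assume i': "i' \<in> {1..n}"
        have "(\<Sum>k' = 1..n. A $$ (i - 1, i' - 1) * C $$ (k - 1, k' - 1) * special_tensor n (i', n + 1 - s, k'))
          = (\<Sum>k' = 1..n. if i' = s \<and> k' < n \<and> (s = 1 \<or> k' = n + 1 - s)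
              then A $$ (i - 1, i' - 1) * C $$ (k - 1, k' - 1) else 0) +
            (\<Sum>k' = 1..n. if k' = n then if i' + 1 = s
              then A $$ (i - 1, i' - 1) * C $$ (k - 1, k' - 1) else 0 else 0)"
          unfolding sum.distrib[symmetric]
          by (intro sum.cong refl, subst special_tensor_slice[OF s i']) (auto simp: distrib_left)
        also have "(\<Sum>k' = 1..n. if i' = s \<and> k' < n \<and> (s = 1 \<or> k' = n + 1 - s)
              then A $$ (i - 1, i' - 1) * C $$ (k - 1, k' - 1) else 0) =
            (if i' = s then A $$ (i - 1, i' - 1) * \<alpha> s k else 0)"
        proof (cases "i' = s")
          case i's: True
          show ?thesis
          proof (cases "s = 1")
            case True
            have "(\<Sum>k' = 1..n. if k' < n then A $$ (i - 1, i' - 1) * C $$ (k - 1, k' - 1) else 0) =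
                (\<Sum>k' = 1..n - 1. A $$ (i - 1, i' - 1) * C $$ (k - 1, k' - 1))"
              by (rule sum.mono_neutral_cong_right) auto
            with True i's show ?thesis by (simp add: \<alpha>_def sum_distrib_left)
          next
            case False
            have "(\<Sum>k' = 1..n. if k' < n \<and> k' = n + 1 - s
                then A $$ (i - 1, i' - 1) * C $$ (k - 1, k' - 1) else 0) =
                (\<Sum>k' = 1..n. if k' = n + 1 - s
                then A $$ (i - 1, i' - 1) * C $$ (k - 1, n - s) else 0)"
              using s False by (intro sum.cong) auto
            also have "\<dots> = A $$ (i - 1, i' - 1) * C $$ (k - 1, n - s)"
              using s by (subst sum.delta) auto
            finally show ?thesis using False i's by (simp add: \<alpha>_def)
          qed
        qed simp
        also have "(\<Sum>k' = 1..n. if k' = n then if i' + 1 = s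
              then A $$ (i - 1, i' - 1) * C $$ (k - 1, k' - 1) else 0 else 0) =
            (if i' + 1 = s then A $$ (i - 1, i' - 1) * \<tau> k else 0)"
          using n by (subst sum.delta) (auto simp: \<tau>_def)
        finally show "(\<Sum>k' = 1..n. A $$ (i - 1, i' - 1) * C $$ (k - 1, k' - 1) * special_tensor n (i', n + 1 - s, k'))
          = (if i' = s then A $$ (i - 1, i' - 1) * \<alpha> s k else 0) +
            (if i' + 1 = s then A $$ (i - 1, i' - 1) * \<tau> k else 0)" .
      qed
      also have "\<dots> = (\<Sum>i' = 1..n. if i' = s then A $$ (i - 1, i' - 1) * \<alpha> s k else 0) +
          (\<Sum>i' = 1..n. if i' = s - 1 then A $$ (i - 1, i' - 1) * \<tau> k else 0)"
        unfolding sum.distrib[symmetric] using s by (intro sum.cong refl) auto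
      also have "\<dots> = \<alpha> s k * v s i + \<tau> k * v (s - 1) i"
        using s by (auto simp: v_def)
      finally show ?thesis .
    qed
  qed (auto simp: v_def)
  note single = diagonal_form_single_coordinate[OF this]

  have in_n: "r \<in> {1..n}" if "r \<in> {1..n - 1}" for r
    using that by auto
  \<comment> \<open>The pairing of row \<open>r\<close> of the inverse with column \<open>r\<close>
    of \<open>C\<close> is 1, so some summand is nonzero. Both its factors matter: the one from
    \<open>C\<close> for \<open>column\<close>, the other for \<open>inj\<close>.\<close>
  have "\<exists>\<kappa>. \<forall>r\<in>{1..n - 1}. \<kappa> r \<in> {1..n} \<and> Ci r (\<kappa> r) * C $$ (\<kappa> r - 1, r - 1) \<noteq> 0"
  proof (intro bchoice ballI)
    fix r assume "r \<in> {1..n - 1}"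
    then have "(\<Sum>k = 1..n. Ci r k * C $$ (k - 1, r - 1)) \<noteq> 0"
      using Ci[OF in_n in_n, of r r] by simp
    then show "\<exists>k. k \<in> {1..n} \<and> Ci r k * C $$ (k - 1, r - 1) \<noteq> 0"
      by (meson sum.neutral)
  qed
  then obtain \<kappa> where "\<forall>r\<in>{1..n - 1}. \<kappa> r \<in> {1..n} \<and> Ci r (\<kappa> r) * C $$ (\<kappa> r - 1, r - 1) \<noteq> 0"
    by blast
  then have \<kappa>: "\<kappa> r \<in> {1..n}" "Ci r (\<kappa> r) \<noteq> 0" "C $$ (\<kappa> r - 1, r - 1) \<noteq> 0"
    if "r \<in> {1..n - 1}" for r
    using that by fastforce+
  have column: "C $$ (k - 1, r - 1) = 0" if "r \<in> {1..n - 1}" "k \<in> {1..n}" "k \<noteq> \<kappa> r" for k r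
  proof (rule ccontr)
    assume nz: "C $$ (k - 1, r - 1) \<noteq> 0"
    have "n + 1 - r \<in> {1..n}" "n + 1 - r \<noteq> 1" "n - (n + 1 - r) = r - 1"
      using that(1) by auto
    with single[of "n + 1 - r" k "\<kappa> r"] nz \<kappa>(1,3)[OF that(1)] that show False
      by (simp add: \<alpha>_def)
  qed
  have inj: "\<kappa> r \<noteq> \<kappa> t" if "r \<in> {1..n - 1}" "t \<in> {1..n - 1}" "r \<noteq> t" for r t
  proof
    assume eq: "\<kappa> r = \<kappa> t"
    \<comment> \<open>Column \<open>t\<close> is zero off \<open>\<kappa> t\<close>, so its zero
      pairing with row \<open>r\<close> of the inverse reduces to one term, which would be
      nonzero.\<close>
    have "(\<Sum>k\<in>{1..n} - {\<kappa> t}. Ci r k * C $$ (k - 1, t - 1)) = 0"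
      using column[OF that(2)] by (intro sum.neutral) auto
    moreover have "(\<Sum>k = 1..n. Ci r k * C $$ (k - 1, t - 1)) = 0"
      using Ci[OF in_n in_n, of r t] that by simp
    ultimately have "Ci r (\<kappa> t) * C $$ (\<kappa> t - 1, t - 1) = 0"
      using sum.remove[of "{1..n}" "\<kappa> t" "\<lambda>k. Ci r k * C $$ (k - 1, t - 1)"] \<kappa>(1)[OF that(2)]
      by simp
    with \<kappa>(2)[OF that(1)] \<kappa>(3)[OF that(2)] eq show False by simp
  qed
  \<comment> \<open>Row \<open>\<kappa> r\<close> meets no other of the first \<open>n - 1\<close>
    columns, so nothing cancels in the sum.\<close>
  have first: "\<alpha> 1 (\<kappa> r) \<noteq> 0" if r: "r \<in> {1..n - 1}" for r
  proof -
    have "(\<Sum>t\<in>{1..n - 1} - {r}. C $$ (\<kappa> r - 1, t - 1)) = 0"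
      using column[OF _ \<kappa>(1)[OF r]] inj[OF r] by (intro sum.neutral) auto
    then show ?thesis
      using sum.remove[of "{1..n - 1}" r "\<lambda>t. C $$ (\<kappa> r - 1, t - 1)"] r \<kappa>(3)[OF r]
      by (simp add: \<alpha>_def)
  qed
  have "1 \<in> {1..n - 1}" "2 \<in> {1..n - 1}" using n by auto
  with single[of 1 "\<kappa> 1" "\<kappa> 2"] first \<kappa>(1) inj[of 1 2] n show False
    by auto
qed

section \<open>Generic tensors\<close>

lemma sum_cube:
  "(\<Sum>i = 1..n. \<Sum>j = 1..n. \<Sum>k = 1..n. f i j k) = (\<Sum>(i, j, k)\<in>cube n. f i j k)"
  by (simp add: cube_def sum.cartesian_product)

lemma triple_product:
  fixes f :: "'a \<Rightarrow> 'd::comm_semiring_0"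
  shows "sum f I * sum g J * sum h K * t = (\<Sum>i\<in>I. \<Sum>j\<in>J. \<Sum>k\<in>K. f i * g j * h k * t)"
proof -
  have "sum f I * sum g J * sum h K * t = (\<Sum>i\<in>I. f i * (sum g J * (sum h K * t)))"
    by (simp only: mult.assoc sum_distrib_right[where A = I])
  also have "\<dots> = (\<Sum>i\<in>I. f i * (\<Sum>j\<in>J. g j * (\<Sum>k\<in>K. h k * t)))"
    by (simp only: sum_distrib_right)
  also have "\<dots> = (\<Sum>i\<in>I. \<Sum>j\<in>J. \<Sum>k\<in>K. f i * g j * h k * t)"
    by (simp only: sum_distrib_left mult.assoc)
  finally show ?thesis .
qed

lemma act_act:
  assumes A: "A \<in> carrier_mat n n" "A' \<in> carrier_mat n n"
    and B: "B \<in> carrier_mat n n" "B' \<in> carrier_mat n n"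
    and C: "C \<in> carrier_mat n n" "C' \<in> carrier_mat n n"
  shows "act n A' B' C' (act n A B C T) = act n (A' * A) (B' * B) (C' * C) T"
proof
  fix p
  show "act n A' B' C' (act n A B C T) p = act n (A' * A) (B' * B) (C' * C) T p"
  proof (cases "p \<in> cube n")
    case False
    then show ?thesis by (simp add: act_outside_cube)
  next
    case True
    then obtain a b c where p: "p = (a, b, c)"
      and abc: "a \<in> {1..n}" "b \<in> {1..n}" "c \<in> {1..n}"
      by (auto simp: cube_def)
    define F where "F i j k i' j' k' =
      A' $$ (a - 1, i - 1) * B' $$ (b - 1, j - 1) * C' $$ (c - 1, k - 1) *
      (A $$ (i - 1, i' - 1) * B $$ (j - 1, j' - 1) * C $$ (k - 1, k' - 1) * T (i', j', k'))"
      for i j k i' j' k'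
    have "act n A' B' C' (act n A B C T) p =
        (\<Sum>i = 1..n. \<Sum>j = 1..n. \<Sum>k = 1..n.
          A' $$ (a - 1, i - 1) * B' $$ (b - 1, j - 1) * C' $$ (c - 1, k - 1) * act n A B C T (i, j, k))"
      using True unfolding p act_def[of n A' B' C'] by simp
    also have "\<dots> = (\<Sum>i = 1..n. \<Sum>j = 1..n. \<Sum>k = 1..n. \<Sum>(i', j', k')\<in>cube n. F i j k i' j' k')"
    proof (intro sum.cong refl)
      fix i j k assume "i \<in> {1..n}" "j \<in> {1..n}" "k \<in> {1..n}"
      then have "act n A B C T (i, j, k) = (\<Sum>(i', j', k')\<in>cube n.
          A $$ (i - 1, i' - 1) * B $$ (j - 1, j' - 1) * C $$ (k - 1, k' - 1) * T (i', j', k'))"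
        unfolding sum_cube[symmetric] by (auto simp: act_def cube_def)
      then show "A' $$ (a - 1, i - 1) * B' $$ (b - 1, j - 1) * C' $$ (c - 1, k - 1) *
          act n A B C T (i, j, k) = (\<Sum>(i', j', k')\<in>cube n. F i j k i' j' k')"
        by (simp only: sum_distrib_left F_def case_prod_unfold)
    qed
    also have "\<dots> = (\<Sum>(i', j', k')\<in>cube n. \<Sum>(i, j, k)\<in>cube n. F i j k i' j' k')"
      unfolding sum_cube case_prod_unfold by (rule sum.swap)
    also have "\<dots> = (\<Sum>(i', j', k')\<in>cube n. (A' * A) $$ (a - 1, i' - 1) *
        (B' * B) $$ (b - 1, j' - 1) * (C' * C) $$ (c - 1, k' - 1) * T (i', j', k'))"
    proof (rule sum.cong[OF refl], clarify)
      fix i' j' k' assume "(i', j', k') \<in> cube n"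
      then have i': "i' \<in> {1..n}" and j': "j' \<in> {1..n}" and k': "k' \<in> {1..n}"
        by (auto simp: cube_def)
      show "(\<Sum>(i, j, k)\<in>cube n. F i j k i' j' k') = (A' * A) $$ (a - 1, i' - 1) *
        (B' * B) $$ (b - 1, j' - 1) * (C' * C) $$ (c - 1, k' - 1) * T (i', j', k')"
        unfolding index_mult_shift[OF A(2,1) abc(1) i'] index_mult_shift[OF B(2,1) abc(2) j']
          index_mult_shift[OF C(2,1) abc(3) k'] triple_product sum_cube[symmetric] F_def
        by (intro sum.cong refl) (simp only: mult_ac)
    qed
    also have "\<dots> = act n (A' * A) (B' * B) (C' * C) T p"
      using True unfolding p sum_cube[symmetric] act_def by simp
    finally show ?thesis .
  qed
qed

text \<open>Basis changes that make \<open>S\<close> free, composed with the equivalence, make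
  \<open>T\<close> free.\<close>

lemma free_tensor_equivalent:
  assumes "equivalent_tensors n S T" "free_tensor n S"
  shows "free_tensor n T"
proof -
  from assms obtain A B C A' B' C' where
    GL: "A \<in> GL n" "B \<in> GL n" "C \<in> GL n" "A' \<in> GL n" "B' \<in> GL n" "C' \<in> GL n"
    and "free_set (supp n (act n A' B' C' (act n A B C T)))"
    by (auto simp: equivalent_tensors_def free_tensor_def)
  then have "free_set (supp n (act n (A' * A) (B' * B) (C' * C) T))"
    by (subst (asm) act_act) (auto simp: GL_def)
  with GL show ?thesis
    unfolding free_tensor_def by (blast intro: GL_mult)
qed

section \<open>Determinants and adjugates as polynomial functions\<close>

lemma polynomial_functions_sum:
  "(\<And>x. x \<in> X \<Longrightarrow> f x \<in> polynomial_functions n) \<Longrightarrow>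
    (\<lambda>T. \<Sum>x\<in>X. f x T) \<in> polynomial_functions n"
  by (induction X rule: infinite_finite_induct)
    (auto intro: polynomial_functions.intros)

lemma polynomial_functions_prod:
  "(\<And>x. x \<in> X \<Longrightarrow> f x \<in> polynomial_functions n) \<Longrightarrow>
    (\<lambda>T. \<Prod>x\<in>X. f x T) \<in> polynomial_functions n"
  by (induction X rule: infinite_finite_induct)
    (auto intro: polynomial_functions.intros)

lemma polynomial_functions_det:
  assumes M: "\<And>T. M T \<in> carrier_mat m m"
    and entry: "\<And>i j. i < m \<Longrightarrow> j < m \<Longrightarrow> (\<lambda>T. M T $$ (i, j)) \<in> polynomial_functions n"
  shows "(\<lambda>T. det (M T)) \<in> polynomial_functions n"
proof -
  have "p i < m" if "p permutes {0..<m}" "i \<in> {0..<m}" for p i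
    using that permutes_in_image[of p "{0..<m}" i] by auto
  then show ?thesis
    unfolding det_def'[OF M]
    by (intro polynomial_functions_sum polynomial_functions.mult polynomial_functions.const
        polynomial_functions_prod entry) auto
qed

lemma polynomial_functions_adj_mat:
  assumes M: "\<And>T. M T \<in> carrier_mat m m"
    and entry: "\<And>i j. i < m \<Longrightarrow> j < m \<Longrightarrow> (\<lambda>T. M T $$ (i, j)) \<in> polynomial_functions n"
    and ij: "i < m" "j < m"
  shows "(\<lambda>T. adj_mat (M T) $$ (i, j)) \<in> polynomial_functions n"
proof -
  have "(\<lambda>T. det (mat_delete (M T) j i)) \<in> polynomial_functions n"
  proof (rule polynomial_functions_det[where m = "m - 1"])
    show "mat_delete (M T) j i \<in> carrier_mat (m - 1) (m - 1)" for T
      using M[of T] by (auto simp: mat_delete_def)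
    fix i' j' assume "i' < m - 1" "j' < m - 1"
    then have "mat_delete (M T) j i $$ (i', j') =
        M T $$ (if i' < j then i' else Suc i', if j' < i then j' else Suc j')" for T
      using M[of T] by (auto simp: mat_delete_def)
    then show "(\<lambda>T. mat_delete (M T) j i $$ (i', j')) \<in> polynomial_functions n"
      using \<open>i' < m - 1\<close> \<open>j' < m - 1\<close> by (simp add: entry)
  qed
  moreover have "adj_mat (M T) $$ (i, j) = (-1) ^ (j + i) * det (mat_delete (M T) j i)" for T
    using M[of T] ij by (simp add: adj_mat_def cofactor_def)
  ultimately show ?thesis
    by (simp add: polynomial_functions.mult polynomial_functions.const)
qed

section \<open>Diagonal basis changes and the genericity polynomial\<close>

definition diagonal_matrix :: "nat \<Rightarrow> (nat \<Rightarrow> complex) \<Rightarrow> complex mat" where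
  "diagonal_matrix n d = mat n n (\<lambda>(i, j). if i = j then d i else 0)"

lemma diagonal_matrix_GL:
  assumes "\<And>i. i < n \<Longrightarrow> d i \<noteq> 0"
  shows "diagonal_matrix n d \<in> GL n"
proof -
  have carrier: "diagonal_matrix n d \<in> carrier_mat n n"
    by (simp add: diagonal_matrix_def)
  moreover have "upper_triangular (diagonal_matrix n d)"
    by (auto simp: diagonal_matrix_def)
  then have "det (diagonal_matrix n d) = prod_list (diag_mat (diagonal_matrix n d))"
    using carrier by (rule det_upper_triangular)
  then have "det (diagonal_matrix n d) \<noteq> 0"
    using assms by (auto simp: prod_list_zero_iff diag_mat_def diagonal_matrix_def)
  ultimately show ?thesis by (simp add: GL_iff_det)
qed

lemma act_diagonal:
  assumes "i \<in> {1..n}" "j \<in> {1..n}" "k \<in> {1..n}"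
  shows "act n (diagonal_matrix n a) (diagonal_matrix n b) C T (i, j, k) =
    a (i - 1) * b (j - 1) * (\<Sum>k' = 1..n. C $$ (k - 1, k' - 1) * T (i, j, k'))"
proof -
  have shift: "x - 1 = y - 1 \<longleftrightarrow> x = y" if "x \<in> {1..n}" "y \<in> {1..n}" for x y :: nat
    using that by auto
  have "act n (diagonal_matrix n a) (diagonal_matrix n b) C T (i, j, k) =
    (\<Sum>i' = 1..n. \<Sum>j' = 1..n. \<Sum>k' = 1..n.
      diagonal_matrix n a $$ (i - 1, i' - 1) * diagonal_matrix n b $$ (j - 1, j' - 1) *
      C $$ (k - 1, k' - 1) * T (i', j', k'))"
    using assms by (simp add: act_def cube_def)
  also have "\<dots> = (\<Sum>i' = 1..n. if i' = i then \<Sum>j' = 1..n. if j' = j then \<Sum>k' = 1..n.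
      a (i - 1) * b (j - 1) * (C $$ (k - 1, k' - 1) * T (i, j, k')) else 0 else 0)"
  proof (rule sum.cong[OF refl])
    fix i' assume i': "i' \<in> {1..n}"
    have A: "diagonal_matrix n a $$ (i - 1, i' - 1) = (if i' = i then a (i - 1) else 0)"
      using shift[OF assms(1) i'] assms(1) i' by (auto simp: diagonal_matrix_def)
    have B: "diagonal_matrix n b $$ (j - 1, j' - 1) = (if j' = j then b (j - 1) else 0)"
      if "j' \<in> {1..n}" for j'
      using shift[OF assms(2) that] assms(2) that by (auto simp: diagonal_matrix_def)
    show "(\<Sum>j' = 1..n. \<Sum>k' = 1..n.
      diagonal_matrix n a $$ (i - 1, i' - 1) * diagonal_matrix n b $$ (j - 1, j' - 1) *
      C $$ (k - 1, k' - 1) * T (i', j', k')) =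
      (if i' = i then \<Sum>j' = 1..n. if j' = j then \<Sum>k' = 1..n.
      a (i - 1) * b (j - 1) * (C $$ (k - 1, k' - 1) * T (i, j, k')) else 0 else 0)"
    proof (cases "i' = i")
      case True
      have "(\<Sum>k' = 1..n. diagonal_matrix n a $$ (i - 1, i' - 1) *
          diagonal_matrix n b $$ (j - 1, j' - 1) * C $$ (k - 1, k' - 1) * T (i', j', k')) =
          (if j' = j then \<Sum>k' = 1..n.
            a (i - 1) * b (j - 1) * (C $$ (k - 1, k' - 1) * T (i, j, k')) else 0)"
        if "j' \<in> {1..n}" for j'
        unfolding A B[OF that] using True by (cases "j' = j") (simp_all only: mult.assoc, simp_all)
      with True show ?thesis by simp
    qed (simp add: A del: One_nat_def)
  qed
  also have "\<dots> = a (i - 1) * b (j - 1) * (\<Sum>k' = 1..n. C $$ (k - 1, k' - 1) * T (i, j, k'))"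
    using assms by (simp add: sum_distrib_left)
  finally show ?thesis .
qed

text \<open>The leading block holds the entries with \<open>2 \<le> i\<close> and \<open>k < n\<close>, indexed from \<open>0\<close>; the last
  diagonal entry only pads the matrix to size \<open>n\<close>.\<close>

definition antidiagonal_matrix :: "nat \<Rightarrow> tensor \<Rightarrow> complex mat" where
  "antidiagonal_matrix n S = mat n n (\<lambda>(r, k).
     if r < n - 1 \<and> k < n - 1 then S (n - r, r + 1, k + 1) else if r = k then 1 else 0)"

text \<open>Cramer numerators: divided by the determinant they express the entries
  \<open>S (1, n, k)\<close> with \<open>k < n\<close> through the rows of the leading
  block.\<close>

definition relation_coeff :: "nat \<Rightarrow> tensor \<Rightarrow> nat \<Rightarrow> complex" where
  "relation_coeff n S r =
     (\<Sum>l<n - 1. S (1, n, l + 1) * adj_mat (antidiagonal_matrix n S) $$ (l, r))"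

text \<open>Nonvanishing means that the rows of the leading block are independent, that the first
  antidiagonal involves all of them, and that the entries of slice \<open>n\<close> with
  \<open>i + j = n\<close> are nonzero.\<close>

definition genericity_polynomial :: "nat \<Rightarrow> tensor \<Rightarrow> complex" where
  "genericity_polynomial n S =
     det (antidiagonal_matrix n S) * (\<Prod>r<n - 1. relation_coeff n S r) * (\<Prod>i = 1..n - 1. S (i, n - i, n))"

lemma antidiagonal_matrix_carrier [simp]: "antidiagonal_matrix n S \<in> carrier_mat n n"
  by (simp add: antidiagonal_matrix_def)

lemma polynomial_genericity_polynomial:
  assumes "n \<ge> 1"
  shows "genericity_polynomial n \<in> polynomial_functions n"
proof -
  have entry: "(\<lambda>S. antidiagonal_matrix n S $$ (r, k)) \<in> polynomial_functions n"
    if "r < n" "k < n" for r k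
  proof (cases "r < n - 1 \<and> k < n - 1")
    case True
    then have "(n - r, r + 1, k + 1) \<in> cube n" by (auto simp: cube_def)
    with True that show ?thesis
      by (auto simp: antidiagonal_matrix_def intro: polynomial_functions.coord)
  next
    case False
    then have "(\<lambda>S. antidiagonal_matrix n S $$ (r, k)) = (\<lambda>S. if r = k then 1 else 0)"
      using that by (auto simp: antidiagonal_matrix_def)
    then show ?thesis by (simp only: polynomial_functions.const)
  qed
  have coord: "(\<lambda>S. S (1, n, l + 1)) \<in> polynomial_functions n" if "l < n - 1" for l
    using that by (intro polynomial_functions.coord) (auto simp: cube_def)
  have relation: "(\<lambda>S. relation_coeff n S r) \<in> polynomial_functions n" if "r < n - 1" for r
    unfolding relation_coeff_def
    by (intro polynomial_functions_sum polynomial_functions.mult coord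
        polynomial_functions_adj_mat[where m = n] entry) (use that in auto)
  have "(\<lambda>S. S (i, n - i, n)) \<in> polynomial_functions n" if "i \<in> {1..n - 1}" for i
    using that by (intro polynomial_functions.coord) (auto simp: cube_def)
  then have "(\<lambda>S. det (antidiagonal_matrix n S) * (\<Prod>r<n - 1. relation_coeff n S r) *
      (\<Prod>i = 1..n - 1. S (i, n - i, n))) \<in> polynomial_functions n"
    by (intro polynomial_functions.mult polynomial_functions_prod relation
        polynomial_functions_det[where m = n] entry) auto
  then show ?thesis
    by (simp add: genericity_polynomial_def[abs_def])
qed

text \<open>Here the matrix and its adjugate are the identity and the remaining factors are 1. This
  makes the generic set non-empty.\<close>

lemma genericity_polynomial_special_tensor:
  assumes n: "n \<ge> 2"
  shows "genericity_polynomial n (special_tensor n) \<noteq> 0"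
proof -
  have Y: "antidiagonal_matrix n (special_tensor n) = 1\<^sub>m n"
  proof (rule eq_matI)
    fix r k assume "r < dim_row (1\<^sub>m n)" "k < dim_col (1\<^sub>m n)"
    then have rk: "r < n" "k < n" by simp_all
    show "antidiagonal_matrix n (special_tensor n) $$ (r, k) = 1\<^sub>m n $$ (r, k)"
    proof (cases "r < n - 1 \<and> k < n - 1")
      case True
      then have s: "n - r \<in> {1..n}" "k + 1 \<in> {1..n}" and "n - r \<noteq> 1" "k + 1 < n"
        by auto
      moreover have "n + 1 - (n - r) = r + 1" using rk by simp
      ultimately have "special_tensor n (n - r, r + 1, k + 1) = (if r = k then 1 else 0)"
        using special_tensor_slice[OF s(1,1,2)] by auto
      then show ?thesis
        using True rk by (simp add: antidiagonal_matrix_def)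
    qed (use rk in \<open>auto simp: antidiagonal_matrix_def\<close>)
  qed (simp_all add: antidiagonal_matrix_def)
  have "1 \<cdot>\<^sub>m 1\<^sub>m n = (1\<^sub>m n :: complex mat)"
    by (intro eq_matI) auto
  then have "adj_mat (1\<^sub>m n :: complex mat) = 1\<^sub>m n"
    using adj_mat(1,3)[of "1\<^sub>m n :: complex mat" n] by simp
  moreover have "special_tensor n (1, n, l + 1) = 1" if "l < n - 1" for l
    using special_tensor_slice[of 1 n 1 "l + 1"] that by simp
  ultimately have "relation_coeff n (special_tensor n) r = 1" if "r < n - 1" for r
    using that by (simp add: relation_coeff_def Y if_distrib cong: if_cong)
  moreover have "special_tensor n (i, n - i, n) = 1" if "i \<in> {1..n - 1}" for i
    using special_tensor_slice[of "i + 1" n i n] that by auto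
  ultimately show ?thesis
    by (simp add: genericity_polynomial_def Y)
qed

text \<open>A change \<open>C\<close> of the third basis produces the antidiagonal entries up to the
  scalars \<open>q\<close>; diagonal changes of the first two bases absorb these scalars and adjust
  slice \<open>n\<close>.\<close>

lemma equivalent_special_tensor:
  assumes n: "n \<ge> 2" and S: "S \<in> supported_in n (special_support n)"
    and generic: "genericity_polynomial n S \<noteq> 0"
  shows "equivalent_tensors n S (special_tensor n)"
proof -
  define Y where "Y = antidiagonal_matrix n S"
  define q where "q r = relation_coeff n S r / det Y" for r
  define y where "y i = S (i, n - i, n)" for i
  have Y: "Y \<in> carrier_mat n n" and det: "det Y \<noteq> 0"
    using generic by (auto simp: Y_def genericity_polynomial_def)
  have q: "q r \<noteq> 0" if "r < n - 1" for r
    using generic that det by (auto simp: q_def genericity_polynomial_def)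
  have y: "y i \<noteq> 0" if "i \<in> {1..n - 1}" for i
    using generic that by (auto simp: y_def genericity_polynomial_def)
  have Y_block: "Y $$ (r, k) = S (n - r, r + 1, k + 1)" if "r < n - 1" "k < n - 1" for r k
    using that by (simp add: Y_def antidiagonal_matrix_def)
  have Y_row: "Y $$ (n - 1, k) = (if k = n - 1 then 1 else 0)" if "k < n" for k
    using that n by (auto simp: Y_def antidiagonal_matrix_def)
  have Y_col: "Y $$ (r, n - 1) = (if r = n - 1 then 1 else 0)" if "r < n" for r
    using that n by (auto simp: Y_def antidiagonal_matrix_def)
  have relation: "(\<Sum>r<n - 1. q r * Y $$ (r, k)) = S (1, n, k + 1)" if k: "k < n - 1" for k
  proof -
    \<comment> \<open>The padding row is zero in columns \<open>k < n - 1\<close>, so the product of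
      adjugate and matrix can be summed over the block only.\<close>
    have adj: "(\<Sum>r<n - 1. adj_mat Y $$ (l, r) * Y $$ (r, k)) = (if l = k then det Y else 0)"
      if l: "l < n - 1" for l
    proof -
      have "(\<Sum>r<n. adj_mat Y $$ (l, r) * Y $$ (r, k)) = (adj_mat Y * Y) $$ (l, k)"
        using adj_mat(1)[OF Y] Y k l by (auto simp: scalar_prod_def lessThan_atLeast0)
      also have "\<dots> = (if l = k then det Y else 0)"
        using adj_mat(3)[OF Y] k l by simp
      also have "(\<Sum>r<n. adj_mat Y $$ (l, r) * Y $$ (r, k)) =
          (\<Sum>r<n - 1. adj_mat Y $$ (l, r) * Y $$ (r, k))"
        using Y_row[of k] k n sum.lessThan_Suc[of "\<lambda>r. adj_mat Y $$ (l, r) * Y $$ (r, k)" "n - 1"]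
        by simp
      finally show ?thesis .
    qed
    have "(\<Sum>r<n - 1. q r * Y $$ (r, k)) =
        (\<Sum>r<n - 1. \<Sum>l<n - 1. S (1, n, l + 1) * (adj_mat Y $$ (l, r) * Y $$ (r, k))) / det Y"
      unfolding q_def relation_coeff_def Y_def[symmetric] sum_divide_distrib[where A = "{..<n - 1}"]
      by (simp add: sum_distrib_right sum_divide_distrib mult.assoc)
    also have "(\<Sum>r<n - 1. \<Sum>l<n - 1. S (1, n, l + 1) * (adj_mat Y $$ (l, r) * Y $$ (r, k))) =
        (\<Sum>l<n - 1. S (1, n, l + 1) * (\<Sum>r<n - 1. adj_mat Y $$ (l, r) * Y $$ (r, k)))"
      unfolding sum_distrib_left by (rule sum.swap)
    also have "\<dots> = (\<Sum>l<n - 1. if l = k then S (1, n, l + 1) * det Y else 0)"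
      using adj by (intro sum.cong) auto
    also have "\<dots> = S (1, n, k + 1) * det Y"
      using k by simp
    finally show ?thesis using det by simp
  qed

  \<comment> \<open>The factor still required at \<open>i = s\<close> after applying
    \<open>C\<close>: none for \<open>s = 1\<close>, where the coefficients \<open>q\<close> belong
    to the sum, and \<open>1 / q (n - s)\<close> otherwise.\<close>
  define p where "p s = (if s = 1 then 1 else 1 / q (n - s))" for s
  have p: "p s \<noteq> 0" if "s \<in> {1..n}" for s
  proof (cases "s = 1")
    case False
    then have "n - s < n - 1" using that by auto
    with q False show ?thesis by (simp add: p_def)
  qed (simp add: p_def)
  \<comment> \<open>Solves \<open>p i * \<beta> (i + 1) / \<beta> i = y i\<close> with
    \<open>\<beta> 1 = 1\<close>. Below, first index \<open>i\<close> is scaled by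
    \<open>p i / \<beta> i\<close> and second index \<open>n + 1 - s\<close> by
    \<open>\<beta> s\<close>: the diagonal gets \<open>p i\<close>, the superdiagonal
    \<open>y i\<close>.\<close>
  define \<beta> where "\<beta> s = (\<Prod>i = 1..<s. y i / p i)" for s
  have \<beta>: "\<beta> s \<noteq> 0" if "s \<in> {1..n}" for s
    unfolding \<beta>_def using y p that by (subst prod_zero_iff) auto
  have \<beta>_Suc: "\<beta> (i + 1) = \<beta> i * (y i / p i)" if "i \<in> {1..n - 1}" for i
    using that by (simp add: \<beta>_def)
  define a where "a i = p (i + 1) / \<beta> (i + 1)" for i
  define b where "b j = \<beta> (n - j)" for j
  define g where "g r = (if r < n - 1 then q r else 1)" for r
  \<comment> \<open>Rows of \<open>Y\<close>, scaled by \<open>q\<close>, become columns; the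
    padding fixes the last basis vector, so slice \<open>n\<close> stays separate.\<close>
  define C where "C = transpose_mat Y * diagonal_matrix n g"
  have GL: "diagonal_matrix n a \<in> GL n" "diagonal_matrix n b \<in> GL n"
    using p \<beta> by (auto intro!: diagonal_matrix_GL simp: a_def b_def)
  have "diagonal_matrix n g \<in> GL n"
    using q by (intro diagonal_matrix_GL) (auto simp: g_def)
  moreover have "transpose_mat Y \<in> GL n"
    using Y det det_transpose[OF Y] by (simp add: GL_iff_det)
  ultimately have "C \<in> GL n"
    unfolding C_def by (intro GL_mult)
  have C: "C $$ (k - 1, r - 1) = Y $$ (r - 1, k - 1) * g (r - 1)"
    if "k \<in> {1..n}" "r \<in> {1..n}" for k r
  proof -
    have "C $$ (k - 1, r - 1) = (\<Sum>l = 0..<n. Y $$ (l, k - 1) * (if l = r - 1 then g l else 0))"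
      unfolding C_def using Y that by (auto simp: scalar_prod_def diagonal_matrix_def intro!: sum.cong)
    also have "\<dots> = (\<Sum>l = 0..<n. if l = r - 1 then Y $$ (l, k - 1) * g l else 0)"
      by (intro sum.cong) auto
    also have "\<dots> = Y $$ (r - 1, k - 1) * g (r - 1)"
      using that by (subst sum.delta) auto
    finally show ?thesis .
  qed
  have C_last_row: "C $$ (n - 1, r - 1) = 0" if "r \<in> {1..n - 1}" for r
    using C[of n r] Y_col[of "r - 1"] that n by auto
  have C_last_col: "C $$ (k - 1, n - 1) = (if k = n then 1 else 0)" if "k \<in> {1..n}" for k
    using C[of k n] Y_row[of "k - 1"] that n by (auto simp: g_def)
  have C_block: "C $$ (k - 1, n - s) = S (s, n + 1 - s, k) * q (n - s)"
    if "k \<in> {1..n - 1}" "s \<in> {2..n}" for k s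
    using C[of k "n + 1 - s"] Y_block[of "n - s" "k - 1"] that by (auto simp: g_def Suc_diff_le)
  have C_sum: "(\<Sum>r = 1..n - 1. C $$ (k - 1, r - 1)) = S (1, n, k)" if "k \<in> {1..n - 1}" for k
  proof -
    have "(\<Sum>r = 1..n - 1. C $$ (k - 1, r - 1)) = (\<Sum>r = 1..n - 1. q (r - 1) * Y $$ (r - 1, k - 1))"
      using C[of k] that by (intro sum.cong) (auto simp: g_def)
    also have "\<dots> = (\<Sum>r<n - 1. q r * Y $$ (r, k - 1))"
      unfolding lessThan_atLeast0 by (rule sum_upto_shift[symmetric])
    also have "\<dots> = S (1, n, k)"
      using relation[of "k - 1"] that by auto
    finally show ?thesis .
  qed

  have outside: "S (i, j, k) = 0" if "(i, j, k) \<notin> special_support n" for i j k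
  proof (cases "(i, j, k) \<in> cube n")
    case True
    with S that show ?thesis by (auto simp: supported_in_def supp_def)
  next
    case False
    with S show ?thesis by (auto simp: supported_in_def tensor_space_def)
  qed
  have main: "act n (diagonal_matrix n a) (diagonal_matrix n b) C (special_tensor n) (i, n + 1 - s, k)
      = S (i, n + 1 - s, k)"
    if i: "i \<in> {1..n}" and s: "s \<in> {1..n}" and k: "k \<in> {1..n}" for i s k
  proof -
    have j: "n + 1 - s \<in> {1..n}" using s by auto
    have ab: "a (i - 1) * b (n + 1 - s - 1) = p i / \<beta> i * \<beta> s"
      using i s by (auto simp: a_def b_def)
    have T: "special_tensor n (i, n + 1 - s, k') =
        (if i = s \<and> k' < n \<and> (s = 1 \<or> k' = n + 1 - s) then 1 else 0) + (if i + 1 = s \<and> k' = n then 1 else 0)"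
      if "k' \<in> {1..n}" for k'
      by (rule special_tensor_slice[OF s i that])
    have "(\<Sum>k' = 1..n. C $$ (k - 1, k' - 1) * special_tensor n (i, n + 1 - s, k')) =
        S (i, n + 1 - s, k) / (p i / \<beta> i * \<beta> s)"
    proof -
      \<comment> \<open>In order: first diagonal position, other diagonal positions, superdiagonal,
        and positions outside the support.\<close>
      consider "i = s" "s = 1" | "i = s" "s \<noteq> 1" | "i + 1 = s" | "i \<noteq> s" "i + 1 \<noteq> s"
        by blast
      then show ?thesis
      proof cases
        case 1
        have "(\<Sum>k' = 1..n. C $$ (k - 1, k' - 1) * special_tensor n (i, n + 1 - s, k')) =
            (\<Sum>k' = 1..n - 1. C $$ (k - 1, k' - 1))"
          using 1 T n by (intro sum.mono_neutral_cong_right) (auto split: if_splits)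
        also have "\<dots> = S (1, n, k)"
        proof (cases "k = n")
          case True
          then have "(1, n, k) \<notin> special_support n" by (simp add: special_support_def)
          with True show ?thesis
            using C_last_row outside by (simp add: sum.neutral del: One_nat_def)
        next
          case False
          with k show ?thesis by (intro C_sum) auto
        qed
        finally show ?thesis
          using 1 \<beta>[OF s] by (simp add: p_def)
      next
        case 2
        have "(\<Sum>k' = 1..n. C $$ (k - 1, k' - 1) * special_tensor n (i, n + 1 - s, k')) =
            (\<Sum>k' = 1..n. if k' = n + 1 - s then C $$ (k - 1, n - s) else 0)"
          using 2 T s by (intro sum.cong) auto
        also have "\<dots> = C $$ (k - 1, n - s)"
          using j by (subst sum.delta) auto
        also have "\<dots> = S (s, n + 1 - s, k) * q (n - s)"
        proof (cases "k = n")
          case True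
          then have "(s, n + 1 - s, k) \<notin> special_support n"
            using s by (auto simp: special_support_def)
          moreover have "2 \<le> s" using 2 s by auto
          then have "n + 1 - s \<in> {1..n - 1}" "n + 1 - s - 1 = n - s" using s by auto
          ultimately show ?thesis
            using C_last_row[of "n + 1 - s"] outside True by simp
        next
          case False
          with k s 2 show ?thesis by (intro C_block) auto
        qed
        finally show ?thesis
          using 2 \<beta>[OF s] by (simp add: p_def)
      next
        case 3
        then have i_less: "i \<in> {1..n - 1}" using i s by auto
        have "(\<Sum>k' = 1..n. C $$ (k - 1, k' - 1) * special_tensor n (i, n + 1 - s, k')) =
            (\<Sum>k' = 1..n. if k' = n then C $$ (k - 1, n - 1) else 0)"
          using 3 T by (intro sum.cong) auto
        also have "\<dots> = C $$ (k - 1, n - 1)"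
          using n by (subst sum.delta) auto
        also have "\<dots> = (if k = n then 1 else 0)"
          by (rule C_last_col[OF k])
        also have "\<dots> = S (i, n + 1 - s, k) / y i"
        proof (cases "k = n")
          case True
          have "S (i, n + 1 - s, k) = y i" using True 3 by (auto simp: y_def)
          with y[OF i_less] True show ?thesis by simp
        next
          case False
          then have "(i, n + 1 - s, k) \<notin> special_support n"
            using 3 s by (auto simp: special_support_def)
          with outside False show ?thesis by simp
        qed
        also have "y i = p i / \<beta> i * \<beta> s"
          using \<beta>_Suc[OF i_less] \<beta>[OF i] p[OF i] 3 by simp
        finally show ?thesis .
      next
        case 4
        then have "(i, n + 1 - s, k) \<notin> special_support n"
          using s by (auto simp: special_support_def)
        with outside show ?thesis
          using 4 T by (simp add: sum.neutral del: One_nat_def)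
      qed
    qed
    then show ?thesis
      unfolding act_diagonal[OF i j k] ab using p[OF i] \<beta>[OF i] \<beta>[OF s] by simp
  qed
  have "S = act n (diagonal_matrix n a) (diagonal_matrix n b) C (special_tensor n)"
  proof
    fix t
    show "S t = act n (diagonal_matrix n a) (diagonal_matrix n b) C (special_tensor n) t"
    proof (cases "t \<in> cube n")
      case True
      then obtain i j k where t: "t = (i, j, k)" and ijk: "i \<in> {1..n}" "j \<in> {1..n}" "k \<in> {1..n}"
        by (auto simp: cube_def)
      then have "n + 1 - j \<in> {1..n}" "n + 1 - (n + 1 - j) = j" by auto
      with main[OF ijk(1) this(1) ijk(3)] show ?thesis by (simp add: t)
    next
      case False
      with S show ?thesis
        by (cases t) (simp add: act_outside_cube supported_in_def tensor_space_def)
    qed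
  qed
  with GL \<open>C \<in> GL n\<close> show ?thesis
    unfolding equivalent_tensors_def by blast
qed

theorem theorem1p1:
  fixes n :: nat
  assumes "n \<ge> 3"
  shows "\<not> free_tensor n (special_tensor n) \<and>
    generic_supported_in n (special_support n)
      (\<lambda>S. equivalent_tensors n S (special_tensor n) \<and> \<not> free_tensor n S)"
proof
  show not_free: "\<not> free_tensor n (special_tensor n)"
    using assms by (rule special_tensor_not_free)
  define L where "L = supported_in n (special_support n)"
  \<comment> \<open>The generic set is the complement in \<open>L\<close> of the zero set of one
    polynomial.\<close>
  define Z where "Z = {T \<in> tensor_space n. genericity_polynomial n T = 0}"
  have "zariski_closed n Z"
    unfolding zariski_closed_def Z_def
    using polynomial_genericity_polynomial[of n] assms
    by (intro exI[of _ "{genericity_polynomial n}"]) auto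
  moreover have "special_tensor n \<in> L - Z"
    using special_tensor_in_supported_in[of n] genericity_polynomial_special_tensor[of n] assms
    by (auto simp: L_def Z_def)
  moreover have "equivalent_tensors n S (special_tensor n) \<and> \<not> free_tensor n S" if "S \<in> L - Z" for S
  proof -
    have "equivalent_tensors n S (special_tensor n)"
      using that assms
      by (intro equivalent_special_tensor) (auto simp: L_def Z_def supported_in_def)
    with not_free free_tensor_equivalent show ?thesis by blast
  qed
  ultimately show "generic_supported_in n (special_support n)
      (\<lambda>S. equivalent_tensors n S (special_tensor n) \<and> \<not> free_tensor n S)"
    unfolding generic_supported_in_def zariski_open_in_def L_def by blast
qed

end
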